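(* Assume that for every $(t,x)\in[0,T]\times X$ the set $f(t,x,U)=\{f(t,x,u):u\in U\}$ is convex, and that there exist $t_1\in[0,T]$ and an admissible control $u\in\mathcal{U}(0,t_1,x_0)$. Let $V\in C^1(\mathbb{R}^{n+1})$ be such that $\mathcal{I}_V(t,x)\ne\emptyset$ for every $(t,x)\in\mathbb{R}_+\times X$. Then there exists a trajectory $(x_V(\cdot),u_V(\cdot))$ starting at $(0,x_0)$, satisfying the differential inclusion $$\dot x_V(t)=f(t,x_V(t),u_V(t))\quad\text{with } u_V(t)\in\mathcal{U}_V(t,x_V(t))$$ over $[0,\infty)$ (for almost every $t$), and such that $x_V(t)\in X$ for almost all $t\in[0,\infty)$.
   Context: Setting. Let $n,m\ge 1$ be integers, $T\ge 0$ a time horizon, $f:\mathbb{R}\times\mathbb{R}^n\times\mathbb{R}^m\to\mathbb{R}^n$ Lipschitz continuous, $U\subset\mathbb{R}^m$ a compact set, $X\subset\mathbb{R}^n$ and $K\subset X$ compact sets, and $x_0\in X$. For $0\le t_0\le t_1\le T$ and $\xi\in\mathbb{R}^n$, $\mathcal{U}(t_0,t_1,\xi)$ is the set of admissible controls: bounded measurable functions $u:[t_0,t_1]\to U$ such that the solution of $\dot x(t)=f(t,x(t),u(t))$ with $x(t_0)=\xi$ is well defined on $[t_0,t_1]$, satisfies $(x(t),u(t))\in X\times U$ for a.e. $t\in[t_0,t_1]$, and satisfies $x(t_1)\in K$. For $V\in C^1(\mathbb{R}^{n+1})$ (a continuously differentiable real-valued function of $(t,x)\in\mathbb{R}\times\mathbb{R}^n$)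 define $$\mathcal{U}_V(t,x)=\operatorname*{argmin}_{u\in U}\nabla_xV(t,x)^\top f(t,x,u),\qquad \mathcal{I}_V(t,x)=\{u\in\mathcal{U}_V(t,x): f(t,x,u)\in T_X(x)\}.$$ Here $T_X(x)$ is the contingent cone to $X$ at $x\in X$: the set of $v\in\mathbb{R}^n$ for which there are sequences $s_k>0$, $s_k\to0$, and $v_k\to v$ with $x+s_kv_k\in X$ for all $k$. A trajectory consists of a locally absolutely continuous $x_V(\cdot)$ with $x_V(0)=x_0$ and a measurable control $u_V(\cdot)$ with values in $U$.
   Formalization: Convexity of f(t,x,U) is assumed for all t ≥ 0 and x in X, not only for t in [0,T]; without it the claim on [0,∞) fails, e.g. U={-1,1}, X=K=[-1,1], x_0=0, V=x², f = u clipped to [-max(0,t-T), max(0,t-T)]. *)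

theory Defs
  imports "HOL-Analysis.Analysis"
begin

definition absolutely_continuous_on :: "real \<Rightarrow> real \<Rightarrow> (real \<Rightarrow> 'a::real_normed_vector) \<Rightarrow> bool" where
  "absolutely_continuous_on a b x \<longleftrightarrow>
     (\<forall>\<epsilon>>0. \<exists>\<delta>>0. \<forall>(N::nat) l r.
        (\<forall>i<N. a \<le> l i \<and> l i \<le> r i \<and> r i \<le> b) \<and>
        (\<forall>i<N. \<forall>j<N. i \<noteq> j \<longrightarrow> {l i<..<r i} \<inter> {l j<..<r j} = {}) \<and>
        (\<Sum>i<N. r i - l i) < \<delta> \<longrightarrow>
        (\<Sum>i<N. norm (x (r i) - x (l i))) < \<epsilon>)"

definition ode_solution_on ::
  "(real \<times> (real^'n) \<times> (real^'m) \<Rightarrow> real^'n) \<Rightarrow> real \<Rightarrow> real \<Rightarrow> real^'n \<Rightarrow> (real \<Rightarrow> real^'m) \<Rightarrow> (real \<Rightarrow> real^'n) \<Rightarrow> bool"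
  where
  "ode_solution_on f t0 t1 \<xi> u x \<longleftrightarrow>
     absolutely_continuous_on t0 t1 x \<and> x t0 = \<xi> \<and>
     (AE t in lebesgue_on {t0..t1}. (x has_vector_derivative f (t, x t, u t)) (at t))"

text \<open>Controls are total functions on the reals; only their values on \<open>[t0, t1]\<close> matter.
  Since \<open>f\<close> is Lipschitz, the state \<open>x\<close> is unique on \<open>[t0, t1]\<close>.\<close>

definition admissible_controls ::
  "(real \<times> (real^'n) \<times> (real^'m) \<Rightarrow> real^'n) \<Rightarrow> (real^'m) set \<Rightarrow> (real^'n) set \<Rightarrow> (real^'n) set \<Rightarrow>
    real \<Rightarrow> real \<Rightarrow> real^'n \<Rightarrow> (real \<Rightarrow> real^'m) set"
  where
  "admissible_controls f U X K t0 t1 \<xi> =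
     {u. u \<in> borel_measurable (lebesgue_on {t0..t1}) \<and> bounded (u ` {t0..t1}) \<and> u ` {t0..t1} \<subseteq> U \<and>
         (\<exists>x. ode_solution_on f t0 t1 \<xi> u x \<and>
              (AE t in lebesgue_on {t0..t1}. x t \<in> X \<and> u t \<in> U) \<and> x t1 \<in> K)}"

text \<open>The library's \<open>C1_differentiable_on\<close> only covers functions of one real variable.\<close>

definition C1_function :: "('a::real_inner \<Rightarrow> real) \<Rightarrow> bool" where
  "C1_function V \<longleftrightarrow> (\<exists>G. (\<forall>z. GDERIV V z :> G z) \<and> continuous_on UNIV G)"

definition grad_x :: "(real \<times> (real^'n) \<Rightarrow> real) \<Rightarrow> real \<Rightarrow> real^'n \<Rightarrow> real^'n" where
  "grad_x V t x = (THE g. GDERIV (\<lambda>y. V (t, y)) x :> g)"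

definition argmin_controls ::
  "(real \<times> (real^'n) \<times> (real^'m) \<Rightarrow> real^'n) \<Rightarrow> (real^'m) set \<Rightarrow> (real \<times> (real^'n) \<Rightarrow> real) \<Rightarrow>
    real \<Rightarrow> real^'n \<Rightarrow> (real^'m) set"
  where
  "argmin_controls f U V t x = {u. is_arg_min (\<lambda>u. grad_x V t x \<bullet> f (t, x, u)) (\<lambda>u. u \<in> U) u}"

definition contingent_cone :: "'a::real_normed_vector set \<Rightarrow> 'a \<Rightarrow> 'a set" where
  "contingent_cone X x =
     {v. \<exists>(s::nat \<Rightarrow> real) w. (\<forall>k. s k > 0) \<and> s \<longlonglongrightarrow> 0 \<and> w \<longlonglongrightarrow> v \<and> (\<forall>k. x + s k *\<^sub>R w k \<in> X)}"

definition viable_argmin_controls ::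
  "(real \<times> (real^'n) \<times> (real^'m) \<Rightarrow> real^'n) \<Rightarrow> (real^'m) set \<Rightarrow> (real^'n) set \<Rightarrow> (real \<times> (real^'n) \<Rightarrow> real) \<Rightarrow>
    real \<Rightarrow> real^'n \<Rightarrow> (real^'m) set"
  where
  "viable_argmin_controls f U X V t x =
     {u \<in> argmin_controls f U V t x. f (t, x, u) \<in> contingent_cone X x}"

definition trajectory ::
  "(real^'m) set \<Rightarrow> real^'n \<Rightarrow> (real \<Rightarrow> real^'n) \<Rightarrow> (real \<Rightarrow> real^'m) \<Rightarrow> bool" where
  "trajectory U x0 x u \<longleftrightarrow>
     (\<forall>a b. 0 \<le> a \<and> a \<le> b \<longrightarrow> absolutely_continuous_on a b x) \<and> x 0 = x0 \<and>
     u \<in> borel_measurable (lebesgue_on {0..}) \<and> (\<forall>t\<ge>0. u t \<in> U)"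

end

(*
  The velocity sets F(t,x) = f(t,x,U_V(t,x)) are compact and convex, since a linear functional is
  minimised over the convex set f(t,x,U), and their graph is closed because f and the gradient of V
  are continuous. As F(t,x) meets the contingent cone of X everywhere, Euler steps with velocities
  close to F can be chosen to end in X again, and the compactness of X keeps the steps from
  accumulating. A pointwise cluster point x of these approximations is locally Lipschitz, hence
  differentiable almost everywhere; upper semicontinuity and convexity of F put every difference
  quotient of x near F(t,x(t)), so x'(t) lies in F(t,x(t)) wherever it exists, and no weak
  compactness of the derivatives is needed. A measurable selection of f(t,x(t),u) = x'(t) yields the
  control; it is automatically minimising, because the minimised quantity depends on u only
  through the velocity.
*)
theory Submission
  imports Defs
begin

section \<open>Differentiability of Lipschitz functions\<close>

text \<open>Since F is only upper semicontinuous, a velocity in \<open>F t x\<close> need not be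
  close to any velocity at nearby points. Neither Picard iteration nor a continuous feedback law is
  at hand, so existence has to come from compactness. The usable Euler step length varies from point
  to point, hence the grids of two approximations have nothing in common; each approximation is kept
  as a step function, and what survives is an estimate on its increments. Step functions are
  discontinuous, which rules out Arzela-Ascoli, but a pointwise cluster point suffices because every
  estimate compares the limit with an approximation at two times only. Differentiability almost
  everywhere comes from measure theory: a Lipschitz function plus a large multiple of t is
  nondecreasing, its Stieltjes measure has a Lebesgue density, and Lebesgue differentiation turns
  that density into a derivative.\<close>

lemma measure_eqI_Ioc:
  fixes M N :: "real measure"
  assumes sets: "sets M = sets borel" "sets N = sets borel"
    and eq: "\<And>a b. emeasure M {a<..b} = emeasure N {a<..b}"
    and fin: "\<And>a b. emeasure M {a<..b} \<noteq> \<infinity>"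
  shows "M = N"
proof (rule measure_eqI_generator_eq[where E = "range (\<lambda>(a, b). {a<..b})" and \<Omega> = UNIV
      and A = "\<lambda>n. {- real n<..real n}"])
  show "Int_stable (range (\<lambda>(a::real, b::real). {a<..b}))"
    by (force simp: Int_stable_def Int_greaterThanAtMost)
  show "(\<Union>n. {- real n<..real n}) = UNIV"
  proof -
    have "\<exists>n. - real n < x \<and> x \<le> real n" for x
    proof -
      obtain n where "\<bar>x\<bar> < real n" using reals_Archimedean2 by blast
      then show ?thesis by (intro exI[of _ n]) auto
    qed
    then show ?thesis by auto
  qed
qed (use fin in \<open>auto simp: eq sets borel_sigma_sets_Ioc\<close>)

text \<open>Stieltjes measures are additive in their distribution function, as a comparison on
  half-open intervals shows. The measure of the sum therefore dominates the measure of G.\<close>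

lemma null_sets_interval_measure_add:
  fixes G H :: "real \<Rightarrow> real"
  assumes G: "mono G" "\<And>a. continuous (at_right a) G"
    and H: "mono H" "\<And>a. continuous (at_right a) H"
    and N: "N \<in> null_sets (interval_measure (\<lambda>t. G t + H t))"
  shows "N \<in> null_sets (interval_measure G)"
proof -
  let ?S = "measure_of UNIV (sets borel) (\<lambda>A. emeasure (interval_measure G) A + emeasure (interval_measure H) A)"
  have em: "emeasure ?S A = emeasure (interval_measure G) A + emeasure (interval_measure H) A"
    if "A \<in> sets borel" for A
  proof (rule emeasure_measure_of_sigma[OF _ _ _ that])
    show "sigma_algebra UNIV (sets (borel::real measure))"
      by (metis sets.sigma_algebra_axioms space_borel)
    show "countably_additive (sets borel) (\<lambda>A. emeasure (interval_measure G) A + emeasure (interval_measure H) A)"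
      unfolding countably_additive_def
      by (auto simp: suminf_add[symmetric] suminf_emeasure image_subset_iff)
  qed (simp add: positive_def)
  have GH: "\<And>x y. x \<le> y \<Longrightarrow> G x \<le> G y" "\<And>x y. x \<le> y \<Longrightarrow> H x \<le> H y"
    using G H by (auto simp: mono_def)
  have eq: "interval_measure (\<lambda>t. G t + H t) = ?S"
  proof (rule measure_eqI_Ioc)
    fix a b :: real
    have *: "emeasure (interval_measure (\<lambda>t. G t + H t)) {a<..b} = (if a \<le> b then G b + H b - (G a + H a) else 0)"
      by (rule emeasure_interval_measure_Ioc_eq) (auto intro: add_mono GH continuous_add G H)
    then show "emeasure (interval_measure (\<lambda>t. G t + H t)) {a<..b} \<noteq> \<infinity>"
      by simp
    have "ennreal (G b + H b - (G a + H a)) = ennreal (G b - G a) + ennreal (H b - H a)" if "a \<le> b"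
      using GH[OF that] by (simp add: ennreal_plus[symmetric] algebra_simps del: ennreal_plus)
    with * show "emeasure (interval_measure (\<lambda>t. G t + H t)) {a<..b} = emeasure ?S {a<..b}"
      by (simp add: em emeasure_interval_measure_Ioc_eq[OF GH(1) G(2)]
          emeasure_interval_measure_Ioc_eq[OF GH(2) H(2)])
    show "sets ?S = sets borel"
      by (metis sets.sigma_sets_eq sets_measure_of_conv space_borel subset_UNIV Pow_UNIV)
  qed simp
  show ?thesis
    using N em[of N] unfolding eq null_sets_def
    by (auto simp: eq[symmetric])
qed

text \<open>Both \<open>M * t + g t\<close> and \<open>M * t - g t\<close> are nondecreasing, and g
  cancels in their sum \<open>2 * M * t\<close>. So the Stieltjes measure of the first is dominated
  by \<open>2 * M\<close> times Lebesgue measure, and Radon-Nikodym gives it a density; subtracting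
  M from this density gives one for g.\<close>

lemma lipschitz_increments_has_integral:
  fixes g :: "real \<Rightarrow> real"
  assumes g: "L-lipschitz_on UNIV g"
  obtains d where "\<And>a b. a \<le> b \<Longrightarrow> (d has_integral g b - g a) {a..b}"
proof -
  have L0: "L \<ge> 0" using g by (rule lipschitz_on_nonneg)
  define M where "M = L + 1"
  have incr: "\<bar>g t - g s\<bar> \<le> M * (t - s)" if "s \<le> t" for s t
  proof -
    have "\<bar>g t - g s\<bar> \<le> L * \<bar>t - s\<bar>"
      using lipschitz_onD[OF g, of t s] by (auto simp: dist_real_def)
    also have "\<dots> \<le> M * (t - s)" using that by (auto simp: M_def algebra_simps)
    finally show ?thesis .
  qed
  define G where "G t = M * t + g t" for t
  define H where "H t = M * t - g t" for t
  have contg: "continuous_on UNIV g" using g by (rule lipschitz_on_continuous_on)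
  then have cg: "isCont g a" for a
    by (simp add: continuous_on_eq_continuous_at)
  have G: "mono G" "\<And>a. continuous (at_right a) G"
  proof -
    show "mono G" using incr by (force simp: mono_def G_def abs_le_iff algebra_simps)
    show "continuous (at_right a) G" for a
      unfolding G_def by (rule continuous_at_imp_continuous_at_within) (intro continuous_intros cg)
  qed
  have H: "mono H" "\<And>a. continuous (at_right a) H"
  proof -
    show "mono H" using incr by (force simp: mono_def H_def abs_le_iff algebra_simps)
    show "continuous (at_right a) H" for a
      unfolding H_def by (rule continuous_at_imp_continuous_at_within) (intro continuous_intros cg)
  qed
  have Gm: "\<And>x y. x \<le> y \<Longrightarrow> G x \<le> G y" using G by (auto simp: mono_def)
  let ?\<mu> = "interval_measure G"
  have scale: "interval_measure (\<lambda>t. G t + H t) = density lborel (\<lambda>_. ennreal (2 * M))"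
    (is "?l = ?r")
  proof (rule measure_eqI_Ioc)
    have M0: "M \<ge> 0" using L0 by (simp add: M_def)
    have GH: "(\<lambda>t. G t + H t) = (\<lambda>t. 2 * M * t)" by (auto simp: G_def H_def)
    have em: "emeasure ?l {a<..b} = (if a \<le> b then 2 * M * b - 2 * M * a else 0)" for a b
      unfolding GH by (rule emeasure_interval_measure_Ioc_eq)
        (auto intro!: mult_left_mono M0 continuous_intros)
    show "emeasure ?l {a<..b} = emeasure ?r {a<..b}" for a b
      using M0 by (simp add: em emeasure_density_const ennreal_mult[symmetric] algebra_simps)
    show "emeasure ?l {a<..b} \<noteq> \<infinity>" for a b
      by (simp add: em)
  qed simp_all
  have "absolutely_continuous lborel ?\<mu>"
    unfolding absolutely_continuous_def
  proof
    fix N :: "real set" assume N: "N \<in> null_sets lborel"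
    have "N \<in> null_sets (interval_measure (\<lambda>t. G t + H t))"
      using N unfolding scale null_sets_def by (auto simp: emeasure_density_const)
    then show "N \<in> null_sets ?\<mu>"
      by (rule null_sets_interval_measure_add[OF G H])
  qed
  then obtain D where D: "D \<in> borel_measurable lborel" and dens: "density lborel D = ?\<mu>"
    using sigma_finite_measure.Radon_Nikodym[OF sigma_finite_lborel, of ?\<mu>] by auto
  have D_Icc: "(\<integral>\<^sup>+t. D t * indicator {a..b} t \<partial>lborel) = ennreal (G b - G a)" if "a \<le> b" for a b
  proof -
    have "(\<integral>\<^sup>+t. D t * indicator {a..b} t \<partial>lborel) = emeasure ?\<mu> {a..b}"
      using D by (subst dens[symmetric]) (simp add: emeasure_density)
    also have "\<dots> = ennreal (G b - G a)"
      using that Gm by (intro emeasure_interval_measure_Icc) (auto simp: G_def intro!: continuous_intros contg)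
    finally show ?thesis .
  qed
  \<comment> \<open>D may take the value \<infinity>, but its integral over each bounded interval is
    finite, so passing to reals changes it only on a null set.\<close>
  define d where "d t = enn2real (D t)" for t
  have "(d has_integral (G b - G a)) {a..b}" if "a \<le> b" for a b
  proof -
    have [measurable]: "D \<in> borel_measurable borel" using D by simp
    have [measurable]: "d \<in> borel_measurable borel" unfolding d_def by measurable
    have "AE t in lborel. D t * indicator {a..b} t \<noteq> \<infinity>"
      by (rule nn_integral_PInf_AE) (auto simp: D_Icc[OF that])
    then have "(\<integral>\<^sup>+t. ennreal (d t * indicator {a..b} t) \<partial>lborel) = (\<integral>\<^sup>+t. D t * indicator {a..b} t \<partial>lborel)"
      by (intro nn_integral_cong_AE) (auto simp: d_def indicator_def less_top elim!: eventually_mono)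
    then have "((\<lambda>t. d t * indicator {a..b} t) has_integral (G b - G a)) UNIV"
      using Gm[OF that] by (intro nn_integral_has_integral) (auto simp: D_Icc[OF that] d_def)
    moreover have "(\<lambda>t. d t * indicator {a..b} t) = (\<lambda>t. if t \<in> {a..b} then d t else 0)"
      by (auto simp: indicator_def)
    ultimately show ?thesis
      by (simp only: has_integral_restrict_UNIV)
  qed
  then have "((\<lambda>t. d t - M) has_integral (G b - G a) - M * (b - a)) {a..b}" if "a \<le> b" for a b
    using that has_integral_const_real[of M a b]
    by (intro has_integral_diff) (auto simp: algebra_simps)
  then show thesis
    by (intro that[of "\<lambda>t. d t - M"]) (simp add: G_def algebra_simps)
qed

text \<open>Lebesgue's differentiation theorem enters for the averages of d over
  \<open>[t, t + h]\<close>. These are the difference quotients of g with h > 0, so only right-hand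
  derivatives result.\<close>

lemma indefinite_integral_AE_right_derivative:
  fixes g :: "real \<Rightarrow> real"
  assumes d: "\<And>a b. a \<le> b \<Longrightarrow> (d has_integral g b - g a) {a..b}"
  obtains N where "negligible N"
    "\<And>t. t \<notin> N \<Longrightarrow> ((\<lambda>h. (g (t + h) - g t) / h) \<longlongrightarrow> d t) (at_right 0)"
proof -
  have "d integrable_on cbox a b" for a b
    using d[of a b] by (cases "a \<le> b") auto
  then obtain N where N: "negligible N" and lim:
    "\<And>x e. \<lbrakk>x \<notin> N; 0 < e\<rbrakk> \<Longrightarrow> \<exists>k>0. \<forall>h. 0 < h \<and> h < k \<longrightarrow>
       norm (integral (cbox x (x + h *\<^sub>R One)) d /\<^sub>R h ^ DIM(real) - d x) < e"
    using integrable_ccontinuous_explicit by blast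
  show thesis
  proof (rule that[OF N])
    fix t assume t: "t \<notin> N"
    show "((\<lambda>h. (g (t + h) - g t) / h) \<longlongrightarrow> d t) (at_right 0)"
    proof (rule tendstoI)
      fix e :: real assume "e > 0"
      then obtain k where k: "k > 0" "\<And>h. 0 < h \<Longrightarrow> h < k \<Longrightarrow> norm (integral (cbox t (t + h)) d / h - d t) < e"
        using lim[OF t \<open>e > 0\<close>] by (auto simp: divide_inverse mult.commute)
      then have "dist ((g (t + h) - g t) / h) (d t) < e" if "0 < h" "h < k" for h
        using k(2)[OF that] integral_unique[OF d[of t "t + h"]] that by (simp add: dist_norm)
      then show "\<forall>\<^sub>F h in at_right 0. dist ((g (t + h) - g t) / h) (d t) < e"
        using k(1) by (auto simp: eventually_at_right_field intro!: exI[of _ k])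
    qed
  qed
qed

lemma lipschitz_AE_differentiable_real:
  fixes g :: "real \<Rightarrow> real"
  assumes g: "L-lipschitz_on UNIV g"
  shows "AE t in lebesgue. \<exists>v. (g has_vector_derivative v) (at t)"
proof -
  obtain d where d: "\<And>a b. a \<le> b \<Longrightarrow> (d has_integral g b - g a) {a..b}"
    using lipschitz_increments_has_integral[OF g] by blast
  \<comment> \<open>Left-hand derivatives come from reflection: the function
    \<open>- g (- s)\<close> has density \<open>d (- s)\<close>, and its right-hand quotient at
    \<open>- t\<close> is the left-hand quotient of g at t. Both one-sided limits are then the same
    number \<open>d t\<close>.\<close>
  have d': "((\<lambda>t. d (- t)) has_integral - g (- b) - - g (- a)) {a..b}" if "a \<le> b" for a b
    using d[of "- b" "- a"] that has_integral_reflect_real[of d _ "- a" "- b"] by simp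
  obtain N1 where N1: "negligible N1"
    and r: "\<And>t. t \<notin> N1 \<Longrightarrow> ((\<lambda>h. (g (t + h) - g t) / h) \<longlongrightarrow> d t) (at_right 0)"
    using indefinite_integral_AE_right_derivative[OF d] by blast
  obtain N2 where N2: "negligible N2"
    and l: "\<And>t. t \<notin> N2 \<Longrightarrow>
      ((\<lambda>h. (- g (- (t + h)) - - g (- t)) / h) \<longlongrightarrow> d (- t)) (at_right 0)"
    using indefinite_integral_AE_right_derivative[OF d'] by blast
  have "negligible (uminus ` N2)"
    using N2 by (intro negligible_differentiable_image_negligible) (auto intro!: derivative_intros)
  then have neg: "negligible (N1 \<union> uminus ` N2)" using N1 by simp
  have "(g has_vector_derivative d t) (at t)" if t: "t \<notin> N1 \<union> uminus ` N2" for t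
  proof -
    have "((\<lambda>h. (g (t + h) - g t) / h) \<longlongrightarrow> d t) (at_left 0)"
    proof -
      have "- t \<notin> N2" using t by (auto simp: image_iff)
      from l[OF this] have "((\<lambda>h. (g (t + - h) - g t) / - h) \<longlongrightarrow> d t) (at_right 0)"
        by (auto simp: minus_divide_left[symmetric] diff_divide_distrib algebra_simps)
      then show ?thesis
        by (subst filterlim_at_left_to_right) simp
    qed
    with r[of t] t have "((\<lambda>h. (g (t + h) - g t) / h) \<longlongrightarrow> d t) (at 0)"
      by (auto intro: filterlim_split_at)
    then have "(g has_field_derivative d t) (at t)"
      by (simp add: DERIV_def)
    then show ?thesis
      by (simp add: has_real_derivative_iff_has_vector_derivative)
  qed
  then show ?thesis
    using neg by (intro AE_I'[of "N1 \<union> uminus ` N2"]) (auto simp: negligible_iff_null_sets)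
qed

lemma lipschitz_AE_differentiable:
  fixes g :: "real \<Rightarrow> 'a::euclidean_space"
  assumes g: "L-lipschitz_on UNIV g"
  shows "AE t in lebesgue. \<exists>v. (g has_vector_derivative v) (at t)"
proof -
  have "AE t in lebesgue. \<exists>v. ((\<lambda>t. g t \<bullet> b) has_vector_derivative v) (at t)"
    if "b \<in> Basis" for b
  proof (rule lipschitz_AE_differentiable_real)
    show "L-lipschitz_on UNIV (\<lambda>t. g t \<bullet> b)"
    proof (rule lipschitz_onI)
      fix s t :: real
      have "dist (g s \<bullet> b) (g t \<bullet> b) \<le> dist (g s) (g t)"
        using Basis_le_norm[OF that, of "g s - g t"] by (simp add: dist_norm inner_diff_left)
      then show "dist (g s \<bullet> b) (g t \<bullet> b) \<le> L * dist s t"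
        using lipschitz_onD[OF g, of s t] by simp
    qed (rule lipschitz_on_nonneg[OF g])
  qed
  then have "AE t in lebesgue. \<forall>b\<in>Basis. \<exists>v. ((\<lambda>t. g t \<bullet> b) has_vector_derivative v) (at t)"
    by (intro AE_finite_allI) auto
  then show ?thesis
  proof (rule eventually_mono)
    fix t assume "\<forall>b\<in>Basis. \<exists>v. ((\<lambda>t. g t \<bullet> b) has_vector_derivative v) (at t)"
    then obtain v where v: "\<forall>b\<in>Basis. ((\<lambda>t. g t \<bullet> b) has_vector_derivative v b) (at t)"
      by metis
    have "(g has_vector_derivative (\<Sum>b\<in>Basis. v b *\<^sub>R b)) (at t)"
      unfolding has_vector_derivative_def
      using v by (subst has_derivative_componentwise_within)
        (simp add: has_vector_derivative_def inner_sum_left_Basis)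
    then show "\<exists>v. (g has_vector_derivative v) (at t)" ..
  qed
qed

section \<open>Viable solutions of differential inclusions\<close>

text \<open>Tychonoff's theorem: every \<open>y k\<close> is a point of a product of copies of the
  compact set X. A product over uncountably many arguments is in general not sequentially compact,
  so this gives a cluster point instead of a convergent subsequence, and the index k depends on the
  finite set A.\<close>

lemma pointwise_cluster_point:
  fixes y :: "nat \<Rightarrow> 'b \<Rightarrow> 'a::metric_space"
  assumes X: "compact X" and y: "\<And>k t. y k t \<in> X"
  shows "\<exists>x. (\<forall>t. x t \<in> X) \<and>
    (\<forall>A e K. finite A \<longrightarrow> 0 < e \<longrightarrow> (\<exists>k\<ge>K. \<forall>t\<in>A. dist (y k t) (x t) < e))"
proof -
  have "compactin (product_topology (\<lambda>_. euclidean) UNIV) (PiE UNIV (\<lambda>_::'b. X))"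
    using X by (simp add: compactin_PiE)
  then have "compact (PiE UNIV (\<lambda>_::'b. X))"
    by (simp add: euclidean_product_topology)
  moreover have "filtermap y sequentially \<noteq> bot"
    by (simp add: filtermap_bot_iff)
  moreover have "eventually (\<lambda>f. f \<in> PiE UNIV (\<lambda>_. X)) (filtermap y sequentially)"
    by (simp add: eventually_filtermap y PiE_iff)
  ultimately obtain x where x: "x \<in> PiE UNIV (\<lambda>_. X)"
    and cluster: "inf (nhds x) (filtermap y sequentially) \<noteq> bot"
    unfolding compact_filter by blast
  show ?thesis
  proof (rule exI[of _ x], intro conjI allI impI)
    show "x t \<in> X" for t using x by auto
    fix A :: "'b set" and e :: real and K :: nat
    assume A: "finite A" and e: "0 < e"
    have "\<forall>\<^sub>F f in nhds x. dist (f t) (x t) < e" for t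
    proof -
      have "open ((\<lambda>f. f t) -` ball (x t) e)"
        by (intro open_vimage open_ball continuous_on_product_coordinates)
      then show ?thesis
        unfolding eventually_nhds using e by (intro exI[of _ "(\<lambda>f. f t) -` ball (x t) e"]) (auto simp: dist_commute)
    qed
    then have "\<forall>\<^sub>F f in nhds x. \<forall>t\<in>A. dist (f t) (x t) < e"
      using A by (simp add: eventually_ball_finite)
    moreover have "\<forall>\<^sub>F f in filtermap y sequentially. \<exists>k\<ge>K. f = y k"
      by (auto simp: eventually_filtermap eventually_sequentially)
    ultimately have "\<forall>\<^sub>F f in inf (nhds x) (filtermap y sequentially).
        (\<forall>t\<in>A. dist (f t) (x t) < e) \<and> (\<exists>k\<ge>K. f = y k)"
      by (auto simp: eventually_inf)
    then show "\<exists>k\<ge>K. \<forall>t\<in>A. dist (y k t) (x t) < e"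
      using eventually_happens'[OF cluster] by blast
  qed
qed

text \<open>These are the hypotheses of the viability theorem for upper semicontinuous maps with
  compact convex values. Compact values and upper semicontinuity follow from
  \<open>closed_graph\<close> and \<open>bounded_F\<close>, nonempty values from
  \<open>viable_F\<close>. The bound is local in time because F may grow as t increases.\<close>

locale viable_inclusion =
  fixes F :: "real \<Rightarrow> 'a::euclidean_space \<Rightarrow> 'a set" and X :: "'a set"
  assumes compact_X: "compact X"
    and convex_F: "\<And>t x. 0 \<le> t \<Longrightarrow> x \<in> X \<Longrightarrow> convex (F t x)"
    and closed_graph: "closed {(t, x, v). 0 \<le> t \<and> x \<in> X \<and> v \<in> F t x}"
    and bounded_F: "\<And>B. \<exists>M. \<forall>t\<in>{0..B}. \<forall>x\<in>X. \<forall>v\<in>F t x. norm v \<le> M"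
    and viable_F: "\<And>t x. 0 \<le> t \<Longrightarrow> x \<in> X \<Longrightarrow> F t x \<inter> contingent_cone X x \<noteq> {}"
begin

section \<open>Closed graph and upper semicontinuity\<close>

lemma F_limit:
  assumes "s \<longlonglongrightarrow> t" "y \<longlonglongrightarrow> x" "v \<longlonglongrightarrow> w"
    and "\<And>n. 0 \<le> s n" "\<And>n. y n \<in> X" "\<And>n. v n \<in> F (s n) (y n)"
  shows "w \<in> F t x"
proof -
  have "(\<lambda>n. (s n, y n, v n)) \<longlonglongrightarrow> (t, x, w)"
    by (intro tendsto_Pair assms)
  then have "(t, x, w) \<in> {(t, x, v). 0 \<le> t \<and> x \<in> X \<and> v \<in> F t x}"
    using closed_sequentially[OF closed_graph, of "\<lambda>n. (s n, y n, v n)" "(t, x, w)"] assms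
    by auto
  then show ?thesis by simp
qed

lemma closed_F:
  assumes "0 \<le> t" "x \<in> X"
  shows "closed (F t x)"
  unfolding closed_sequential_limits
proof (intro allI impI)
  fix v l assume "(\<forall>n. v n \<in> F t x) \<and> v \<longlonglongrightarrow> l"
  then show "l \<in> F t x"
    using F_limit[of "\<lambda>_. t" t "\<lambda>_. x" x v l] assms by auto
qed

text \<open>Otherwise there are velocities at points tending to \<open>(t, x)\<close> that stay
  \<delta> away from \<open>F t x\<close>. They are bounded, so they have a cluster point, and the
  closed graph puts it into \<open>F t x\<close>.\<close>

lemma F_upper_semicontinuous:
  assumes t: "0 \<le> t" and x: "x \<in> X" and \<delta>: "0 < \<delta>"
  obtains \<eta> where "0 < \<eta>"
    "\<And>s y v. 0 \<le> s \<Longrightarrow> y \<in> X \<Longrightarrow> \<bar>s - t\<bar> \<le> \<eta> \<Longrightarrow> dist y x \<le> \<eta> \<Longrightarrow> v \<in> F s y \<Longrightarrow>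
      \<exists>a\<in>F t x. dist v a \<le> \<delta>"
proof -
  let ?Q = "\<lambda>\<eta>. \<forall>s y v. 0 \<le> s \<longrightarrow> y \<in> X \<longrightarrow> \<bar>s - t\<bar> \<le> \<eta> \<longrightarrow> dist y x \<le> \<eta> \<longrightarrow> v \<in> F s y \<longrightarrow>
      (\<exists>a\<in>F t x. dist v a \<le> \<delta>)"
  have False if no: "\<not> (\<exists>\<eta>>0. ?Q \<eta>)"
  proof -
    have "\<not> ?Q (inverse (real (Suc n)))" for n
      using no by (metis inverse_positive_iff_positive of_nat_0_less_iff zero_less_Suc)
    then have "\<exists>s y v. 0 \<le> s \<and> y \<in> X \<and> \<bar>s - t\<bar> \<le> inverse (real (Suc n)) \<and>
        dist y x \<le> inverse (real (Suc n)) \<and> v \<in> F s y \<and> (\<forall>a\<in>F t x. \<delta> < dist v a)" for n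
      by (simp only: not_all not_imp not_le[symmetric]) blast
    then obtain s y v where sy: "\<And>n. 0 \<le> s n" "\<And>n. y n \<in> X"
        "\<And>n. \<bar>s n - t\<bar> \<le> inverse (real (Suc n))" "\<And>n. dist (y n) x \<le> inverse (real (Suc n))"
      and v: "\<And>n. v n \<in> F (s n) (y n)" "\<And>n a. a \<in> F t x \<Longrightarrow> \<delta> < dist (v n) a"
      by metis
    obtain M where M: "\<forall>t\<in>{0..t + 1}. \<forall>x\<in>X. \<forall>v\<in>F t x. norm v \<le> M"
      using bounded_F by blast
    have "s n \<in> {0..t + 1}" for n
    proof -
      have "inverse (real (Suc n)) \<le> 1" by (simp add: field_simps)
      then show ?thesis using sy(1)[of n] sy(3)[of n] by auto
    qed
    then have "\<forall>n. v n \<in> cball 0 M" using M sy v by fastforce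
    then obtain w r where r: "strict_mono r" "(v \<circ> r) \<longlonglongrightarrow> w"
      using compact_cball[of "0::'a" M] unfolding compact_def by metis
    have "s \<longlonglongrightarrow> t"
      by (rule metric_tendsto_imp_tendsto[OF LIMSEQ_inverse_real_of_nat])
        (use sy(3) in \<open>simp add: dist_real_def del: of_nat_Suc\<close>)
    moreover have "y \<longlonglongrightarrow> x"
      by (rule metric_tendsto_imp_tendsto[OF LIMSEQ_inverse_real_of_nat])
        (use sy(4) in \<open>simp del: of_nat_Suc\<close>)
    ultimately have "w \<in> F t x"
      using r sy v by (intro F_limit[of "s \<circ> r" t "y \<circ> r" x "v \<circ> r" w]) (auto intro: LIMSEQ_subseq_LIMSEQ)
    then have "\<delta> \<le> dist (v (r n)) w" for n using v(2)[of w "r n"] by simp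
    moreover have "\<exists>n. dist (v (r n)) w < \<delta>"
      using r(2) \<delta> by (auto simp: lim_sequentially)
    ultimately show False by (meson not_le)
  qed
  then show thesis using that by blast
qed

text \<open>A step length that works at \<open>x\<close> also works, with an error of order \<open>\<epsilon>\<close> in the velocity, at all
  points close to \<open>x\<close>; so compactness bounds the step lengths from below.\<close>

lemma euler_step:
  assumes \<epsilon>: "0 < \<epsilon>"
  obtains h0 where "0 < h0" "h0 \<le> \<epsilon>"
    "\<And>t x. 0 \<le> t \<Longrightarrow> t \<le> B \<Longrightarrow> x \<in> X \<Longrightarrow> \<exists>h w s y v. h0 \<le> h \<and> h \<le> \<epsilon> \<and> x + h *\<^sub>R w \<in> X \<and>
       0 \<le> s \<and> y \<in> X \<and> v \<in> F s y \<and> \<bar>s - t\<bar> \<le> \<epsilon> \<and> dist y x \<le> \<epsilon> \<and> dist w v \<le> 2 * \<epsilon>"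
proof -
  let ?P = "\<lambda>h0 t x. \<exists>h w s y v. h0 \<le> h \<and> h \<le> \<epsilon> \<and> x + h *\<^sub>R w \<in> X \<and>
       0 \<le> s \<and> y \<in> X \<and> v \<in> F s y \<and> \<bar>s - t\<bar> \<le> \<epsilon> \<and> dist y x \<le> \<epsilon> \<and> dist w v \<le> 2 * \<epsilon>"
  have False if no: "\<not> (\<exists>h0>0. h0 \<le> \<epsilon> \<and> (\<forall>t x. 0 \<le> t \<longrightarrow> t \<le> B \<longrightarrow> x \<in> X \<longrightarrow> ?P h0 t x))"
  proof -
    have "\<exists>t x. 0 \<le> t \<and> t \<le> B \<and> x \<in> X \<and> \<not> ?P (\<epsilon> * inverse (real (Suc n))) t x" for n
    proof -
      have "\<epsilon> * inverse (real (Suc n)) \<le> \<epsilon>" "0 < \<epsilon> * inverse (real (Suc n))"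
        using \<epsilon> by (simp_all add: field_simps)
      then show ?thesis using no by blast
    qed
    then obtain t x where tx: "\<And>n. 0 \<le> t n \<and> t n \<le> B \<and> x n \<in> X"
      and bad: "\<And>n. \<not> ?P (\<epsilon> * inverse (real (Suc n))) (t n) (x n)"
      by metis
    have K: "compact ({0..B} \<times> X)" by (intro compact_Times compact_X compact_Icc)
    obtain z r where z: "z \<in> {0..B} \<times> X" and r: "strict_mono r"
      and "((\<lambda>n. (t n, x n)) \<circ> r) \<longlonglongrightarrow> z"
      by (rule seq_compactE[OF compact_imp_seq_compact[OF K], of "\<lambda>n. (t n, x n)"]) (use tx in auto)
    then obtain t' x' where tx': "0 \<le> t'" "x' \<in> X"
      and lim: "(\<lambda>n. (t (r n), x (r n))) \<longlonglongrightarrow> (t', x')"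
      by (cases z) (auto simp: o_def)
    have limt: "(\<lambda>n. t (r n)) \<longlonglongrightarrow> t'" and limx: "(\<lambda>n. x (r n)) \<longlonglongrightarrow> x'"
      using tendsto_fst[OF lim] tendsto_snd[OF lim] by simp_all
    \<comment> \<open>The velocity is taken at the limit point \<open>(t', x')\<close>, not at the
      nearby point where the step starts: by upper semicontinuity alone no velocity close to v has
      to exist there. This is why \<open>?P\<close> lets \<open>(s, y)\<close> differ from
      \<open>(t, x)\<close>.\<close>
    obtain v where v: "v \<in> F t' x'" and cone: "v \<in> contingent_cone X x'"
      using viable_F[OF tx'] by blast
    then obtain s w where s: "\<And>k::nat. 0 < s k" "s \<longlonglongrightarrow> 0" and w: "w \<longlonglongrightarrow> v"
      and sw: "\<And>k. x' + s k *\<^sub>R w k \<in> X"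
      unfolding contingent_cone_def by blast
    have "\<forall>\<^sub>F k in sequentially. s k < \<epsilon> \<and> dist (w k) v < \<epsilon>"
      using order_tendstoD(2)[OF s(2) \<epsilon>] tendstoD[OF w \<epsilon>] by (rule eventually_conj)
    then obtain k where k: "s k < \<epsilon>" "dist (w k) v < \<epsilon>"
      using eventually_happens'[OF sequentially_bot] by blast
    define h where "h = s k"
    have h: "0 < h" "h < \<epsilon>" using s k by (auto simp: h_def)
    have "(\<lambda>n. \<epsilon> * inverse (real (Suc (r n)))) \<longlonglongrightarrow> \<epsilon> * 0"
      using LIMSEQ_subseq_LIMSEQ[OF LIMSEQ_inverse_real_of_nat r]
      by (intro tendsto_mult tendsto_const) (simp add: o_def)
    then have ev1: "\<forall>\<^sub>F n in sequentially. \<epsilon> * inverse (real (Suc (r n))) < h"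
      using h by (intro order_tendstoD(2)) auto
    have ev2: "\<forall>\<^sub>F n in sequentially. dist (t (r n)) t' < \<epsilon>" by (rule tendstoD[OF limt \<epsilon>])
    have ev3: "\<forall>\<^sub>F n in sequentially. dist (x (r n)) x' < \<epsilon>" by (rule tendstoD[OF limx \<epsilon>])
    have ev4: "\<forall>\<^sub>F n in sequentially. dist (x (r n)) x' < \<epsilon> * h"
      using h \<epsilon> by (intro tendstoD[OF limx]) simp
    obtain n where n: "\<epsilon> * inverse (real (Suc (r n))) < h" "dist (t (r n)) t' < \<epsilon>"
      "dist (x (r n)) x' < \<epsilon>" "dist (x (r n)) x' < \<epsilon> * h"
      using eventually_happens'[OF sequentially_bot
          eventually_conj[OF ev1 eventually_conj[OF ev2 eventually_conj[OF ev3 ev4]]]] by blast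
    \<comment> \<open>With this correction the step from \<open>x (r n)\<close> ends exactly at
      \<open>x' + h *\<^sub>R w k\<close>, a point of X. The correction is at most \<epsilon>
      because the distance of the starting points is below \<open>\<epsilon> * h\<close>; the other
      \<epsilon> in the bound is the distance from \<open>w k\<close> to v.\<close>
    define w' where "w' = w k + (x' - x (r n)) /\<^sub>R h"
    have "norm (x' - x (r n)) / h \<le> \<epsilon>"
      using n(4) h by (simp add: field_simps dist_norm norm_minus_commute)
    then have "norm ((x' - x (r n)) /\<^sub>R h) \<le> \<epsilon>"
      using h by (simp add: divide_inverse mult.commute)
    then have "dist w' v \<le> 2 * \<epsilon>"
      using k(2) norm_triangle_ineq[of "w k - v" "(x' - x (r n)) /\<^sub>R h"]
      by (simp add: w'_def dist_norm algebra_simps)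
    moreover have "x (r n) + h *\<^sub>R w' = x' + h *\<^sub>R w k"
      using h by (simp add: w'_def algebra_simps)
    then have "x (r n) + h *\<^sub>R w' \<in> X" using sw[of k] by (simp add: h_def)
    ultimately have "?P (\<epsilon> * inverse (real (Suc (r n)))) (t (r n)) (x (r n))"
      using n h v tx'
      by (intro exI[of _ h] exI[of _ w'] exI[of _ t'] exI[of _ x'] exI[of _ v])
        (auto simp: dist_real_def dist_commute abs_minus_commute)
    then show False using bad by blast
  qed
  then show thesis using that by blast
qed

text \<open>The approximations are step functions that jump at the grid points of an Euler scheme. Averaging
  over the steps puts an increment into a multiple of any convex set \<open>C\<close> containing the nearby
  velocities; the factor \<open>d\<close> is a difference of grid points, hence only close to \<open>t - s\<close>.\<close>

definition euler_approximation :: "real \<Rightarrow> real \<Rightarrow> (real \<Rightarrow> 'a) \<Rightarrow> bool" where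
  "euler_approximation \<epsilon> B y \<longleftrightarrow> (\<forall>t. y t \<in> X) \<and>
    (\<forall>s t C. 0 \<le> s \<and> s \<le> t \<and> t \<le> B \<and> convex C \<and> C \<noteq> {} \<and>
      (\<forall>r r' z v. 0 \<le> r \<and> s - \<epsilon> \<le> r \<and> r \<le> t \<and> 0 \<le> r' \<and> \<bar>r' - r\<bar> \<le> \<epsilon> \<and> z \<in> X \<and>
        dist z (y r) \<le> \<epsilon> \<and> v \<in> F r' z \<longrightarrow> cball v (2 * \<epsilon>) \<subseteq> C) \<longrightarrow>
      (\<exists>d c. \<bar>d - (t - s)\<bar> \<le> \<epsilon> \<and> c \<in> C \<and> y t - y s = d *\<^sub>R c))"

lemma euler_approximationD:
  assumes "euler_approximation \<epsilon> B y" "0 \<le> s" "s \<le> t" "t \<le> B" "convex C" "C \<noteq> {}"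
    and "\<And>r r' z v. 0 \<le> r \<Longrightarrow> s - \<epsilon> \<le> r \<Longrightarrow> r \<le> t \<Longrightarrow> 0 \<le> r' \<Longrightarrow> \<bar>r' - r\<bar> \<le> \<epsilon> \<Longrightarrow> z \<in> X \<Longrightarrow>
        dist z (y r) \<le> \<epsilon> \<Longrightarrow> v \<in> F r' z \<Longrightarrow> cball v (2 * \<epsilon>) \<subseteq> C"
  shows "\<exists>d c. \<bar>d - (t - s)\<bar> \<le> \<epsilon> \<and> c \<in> C \<and> y t - y s = d *\<^sub>R c"
proof (rule assms(1)[unfolded euler_approximation_def, THEN conjunct2, rule_format], intro conjI allI impI)
  fix r r' z v
  assume "0 \<le> r \<and> s - \<epsilon> \<le> r \<and> r \<le> t \<and> 0 \<le> r' \<and> \<bar>r' - r\<bar> \<le> \<epsilon> \<and> z \<in> X \<and> dist z (y r) \<le> \<epsilon> \<and> v \<in> F r' z"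
  then show "cball v (2 * \<epsilon>) \<subseteq> C" by (elim conjE) (rule assms(7))
qed (use assms in auto)

lemma euler_approximation_exists:
  assumes \<epsilon>: "0 < \<epsilon>" and x0: "x0 \<in> X"
  obtains y where "y 0 = x0" "euler_approximation \<epsilon> B y"
proof -
  obtain h0 where h0: "0 < h0" "h0 \<le> \<epsilon>" and step:
    "\<And>t x. 0 \<le> t \<Longrightarrow> t \<le> B \<Longrightarrow> x \<in> X \<Longrightarrow> \<exists>h w s y v. h0 \<le> h \<and> h \<le> \<epsilon> \<and> x + h *\<^sub>R w \<in> X \<and>
       0 \<le> s \<and> y \<in> X \<and> v \<in> F s y \<and> \<bar>s - t\<bar> \<le> \<epsilon> \<and> dist y x \<le> \<epsilon> \<and> dist w v \<le> 2 * \<epsilon>"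
    using euler_step[OF \<epsilon>, of B] by blast
  \<comment> \<open>After time B the scheme goes on with velocity 0 and steps of length \<epsilon>,
    so that the grid is infinite and unbounded.\<close>
  have "\<exists>h w. 0 \<le> t \<longrightarrow> x \<in> X \<longrightarrow> h0 \<le> h \<and> h \<le> \<epsilon> \<and> x + h *\<^sub>R w \<in> X \<and>
      (t \<le> B \<longrightarrow> (\<exists>s y v. 0 \<le> s \<and> y \<in> X \<and> v \<in> F s y \<and> \<bar>s - t\<bar> \<le> \<epsilon> \<and> dist y x \<le> \<epsilon> \<and> dist w v \<le> 2 * \<epsilon>))"
    for t x
  proof (cases "0 \<le> t \<and> t \<le> B \<and> x \<in> X")
    case True
    then show ?thesis using step[of t x] by blast
  next
    case False
    then show ?thesis using h0 by (intro exI[of _ \<epsilon>] exI[of _ 0]) auto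
  qed
  then obtain H W where HW: "\<And>t x. 0 \<le> t \<Longrightarrow> x \<in> X \<Longrightarrow> h0 \<le> H t x \<and> H t x \<le> \<epsilon> \<and> x + H t x *\<^sub>R W t x \<in> X \<and>
      (t \<le> B \<longrightarrow> (\<exists>s y v. 0 \<le> s \<and> y \<in> X \<and> v \<in> F s y \<and> \<bar>s - t\<bar> \<le> \<epsilon> \<and> dist y x \<le> \<epsilon> \<and> dist (W t x) v \<le> 2 * \<epsilon>))"
    by metis
  define Z where "Z = rec_nat (0, x0) (\<lambda>_ (t, x). (t + H t x, x + H t x *\<^sub>R W t x))"
  define \<tau> where "\<tau> i = fst (Z i)" for i
  define \<xi> where "\<xi> i = snd (Z i)" for i
  define h where "h i = H (\<tau> i) (\<xi> i)" for i
  define w where "w i = W (\<tau> i) (\<xi> i)" for i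
  have \<tau>_0: "\<tau> 0 = 0" and \<xi>_0: "\<xi> 0 = x0"
    by (simp_all add: \<tau>_def \<xi>_def Z_def)
  have \<tau>_Suc: "\<tau> (Suc i) = \<tau> i + h i" and \<xi>_Suc: "\<xi> (Suc i) = \<xi> i + h i *\<^sub>R w i" for i
    by (simp_all add: \<tau>_def \<xi>_def h_def w_def Z_def split: prod.split)
  have inv: "0 \<le> \<tau> i \<and> \<xi> i \<in> X" for i
  proof (induction i)
    case 0
    then show ?case by (simp add: \<tau>_0 \<xi>_0 x0)
  next
    case (Suc i)
    then show ?case using HW[of "\<tau> i" "\<xi> i"] h0 by (simp add: \<tau>_Suc \<xi>_Suc h_def w_def)
  qed
  have h: "h0 \<le> h i" "h i \<le> \<epsilon>" for i
    using HW[of "\<tau> i" "\<xi> i"] inv[of i] by (simp_all add: h_def)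
  have w: "\<exists>s y v. 0 \<le> s \<and> y \<in> X \<and> v \<in> F s y \<and> \<bar>s - \<tau> i\<bar> \<le> \<epsilon> \<and> dist y (\<xi> i) \<le> \<epsilon> \<and> dist (w i) v \<le> 2 * \<epsilon>"
    if "\<tau> i \<le> B" for i
    using HW[of "\<tau> i" "\<xi> i"] inv[of i] that by (simp add: w_def)
  have mono: "strict_mono \<tau>"
  proof (rule strict_mono_Suc_iff[THEN iffD2], intro allI)
    show "\<tau> i < \<tau> (Suc i)" for i using h(1)[of i] h0(1) by (simp add: \<tau>_Suc)
  qed
  have large: "real i * h0 \<le> \<tau> i" for i
  proof (induction i)
    case (Suc i)
    then show ?case using h(1)[of i] by (simp add: \<tau>_Suc algebra_simps)
  qed (simp add: \<tau>_0)
  \<comment> \<open>For \<open>0 \<le> t\<close> this is the i with \<tau> i \<le> t < \<tau> (i +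
    1). Negative times get index 0, so the step function below takes values in X on the whole
    line.\<close>
  define idx where "idx t = (LEAST i. t < \<tau> (Suc i))" for t
  have idx_upper: "t < \<tau> (Suc (idx t))" for t
    unfolding idx_def
  proof (rule LeastI_ex)
    obtain n where "t / h0 < real n" using reals_Archimedean2 by blast
    then have "t < real n * h0" using h0 by (simp add: field_simps)
    also have "\<dots> \<le> \<tau> n" by (rule large)
    also have "\<dots> < \<tau> (Suc n)" using mono by (simp add: strict_mono_Suc_iff)
    finally show "\<exists>i. t < \<tau> (Suc i)" by blast
  qed
  have idx_lower: "\<tau> (idx t) \<le> t" if "0 \<le> t" for t
  proof (cases "idx t")
    case 0
    then show ?thesis using that by (simp add: \<tau>_0)
  next
    case (Suc j)
    then have "\<not> t < \<tau> (Suc j)" unfolding idx_def by (intro not_less_Least) simp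
    then show ?thesis by (simp add: Suc)
  qed
  have idx_\<tau>: "idx (\<tau> i) = i" for i
    unfolding idx_def
    by (rule Least_equality) (auto simp: strict_mono_less[OF mono])
  have idx_mono: "idx s \<le> idx t" if "s \<le> t" for s t
    unfolding idx_def[of s] using idx_upper[of t] that by (intro Least_le) simp
  define y where "y t = \<xi> (idx t)" for t
  have y_\<tau>: "y (\<tau> i) = \<xi> i" for i by (simp add: y_def idx_\<tau>)
  show thesis
  proof (rule that)
    show "y 0 = x0" using idx_\<tau>[of 0] by (simp add: y_def \<tau>_0 \<xi>_0)
    show "euler_approximation \<epsilon> B y"
      unfolding euler_approximation_def
    proof (intro conjI allI impI; (elim conjE)?)
      show "y t \<in> X" for t using inv by (simp add: y_def)
      fix s t :: real and C :: "'a set"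
      assume s: "0 \<le> s" "s \<le> t" and t: "t \<le> B" and C: "convex C" "C \<noteq> {}"
        and near: "\<forall>r r' z v. 0 \<le> r \<and> s - \<epsilon> \<le> r \<and> r \<le> t \<and> 0 \<le> r' \<and> \<bar>r' - r\<bar> \<le> \<epsilon> \<and> z \<in> X \<and>
          dist z (y r) \<le> \<epsilon> \<and> v \<in> F r' z \<longrightarrow> cball v (2 * \<epsilon>) \<subseteq> C"
      define p where "p = idx s"
      define q where "q = idx t"
      have pq: "p \<le> q" using idx_mono[OF s(2)] by (simp add: p_def q_def)
      have p: "\<tau> p \<le> s" "s < \<tau> p + \<epsilon>"
        using idx_lower[of s] idx_upper[of s] s h(2)[of p] by (simp_all add: p_def \<tau>_Suc)
      have q: "\<tau> q \<le> t" "t < \<tau> q + \<epsilon>"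
        using idx_lower[of t] idx_upper[of t] s h(2)[of q] by (simp_all add: q_def \<tau>_Suc)
      \<comment> \<open>The first relevant velocity was chosen at the grid time
        \<open>\<tau> p\<close>, which may precede s by almost \<epsilon>; hence \<open>near\<close>
        reaches back to \<open>s - \<epsilon>\<close>.\<close>
      have wC: "w i \<in> C" if i: "p \<le> i" "i \<le> q" for i
      proof -
        have "\<tau> p \<le> \<tau> i" "\<tau> i \<le> \<tau> q"
          using i mono by (simp_all add: strict_mono_less_eq)
        then have i': "s - \<epsilon> \<le> \<tau> i" "\<tau> i \<le> t" using p q by auto
        then obtain r' z v where v: "0 \<le> r'" "z \<in> X" "v \<in> F r' z" "\<bar>r' - \<tau> i\<bar> \<le> \<epsilon>"
          "dist z (\<xi> i) \<le> \<epsilon>" "dist (w i) v \<le> 2 * \<epsilon>"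
          using w[of i] t by fastforce
        then have "cball v (2 * \<epsilon>) \<subseteq> C"
          using i' inv[of i] by (intro near[rule_format, of "\<tau> i" r' z v]) (auto simp: y_\<tau>)
        then show ?thesis using v by (auto simp: dist_commute)
      qed
      \<comment> \<open>An increment between grid points is the sum of the velocities weighted by
        the step lengths. Divided by the elapsed time it is a convex combination of elements of C.
        For \<open>j = p\<close> the factor is 0 and any element of C serves.\<close>
      have "\<exists>c\<in>C. \<xi> j - \<xi> p = (\<tau> j - \<tau> p) *\<^sub>R c" if "p \<le> j" "j \<le> q" for j
        using that
      proof (induction j rule: dec_induct)
        case base
        then show ?case using C by auto
      next
        case (step j)
        then obtain c where c: "c \<in> C" "\<xi> j - \<xi> p = (\<tau> j - \<tau> p) *\<^sub>R c" by auto
        define a where "a = \<tau> j - \<tau> p"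
        have a: "0 \<le> a" using step mono by (simp add: a_def strict_mono_less_eq)
        have hj: "0 < h j" using h(1)[of j] h0 by simp
        let ?c = "(a / (a + h j)) *\<^sub>R c + (h j / (a + h j)) *\<^sub>R w j"
        have "?c \<in> C"
          using a hj step by (intro convexD[OF C(1)] c wC) (auto simp: add_divide_distrib[symmetric])
        moreover have "\<xi> (Suc j) - \<xi> p = (\<tau> (Suc j) - \<tau> p) *\<^sub>R ?c"
        proof -
          have "\<tau> (Suc j) - \<tau> p = a + h j" by (simp add: \<tau>_Suc a_def)
          moreover have "(a + h j) *\<^sub>R ?c = a *\<^sub>R c + h j *\<^sub>R w j"
            using a hj by (simp add: scaleR_add_right)
          moreover have "\<xi> (Suc j) - \<xi> p = a *\<^sub>R c + h j *\<^sub>R w j"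
            using c(2) by (simp add: \<xi>_Suc a_def algebra_simps)
          ultimately show ?thesis by simp
        qed
        ultimately show ?case by blast
      qed
      from this[of q] pq obtain c where "c \<in> C" "\<xi> q - \<xi> p = (\<tau> q - \<tau> p) *\<^sub>R c" by auto
      \<comment> \<open>Both \<open>s - \<tau> p\<close> and \<open>t - \<tau> q\<close> lie between
        0 and \<epsilon>, so their difference, which is the error of d, is at most \<epsilon> rather
        than 2 \<epsilon>.\<close>
      then show "\<exists>d c. \<bar>d - (t - s)\<bar> \<le> \<epsilon> \<and> c \<in> C \<and> y t - y s = d *\<^sub>R c"
        using p q by (intro exI[of _ "\<tau> q - \<tau> p"] exI[of _ c]) (auto simp: y_def p_def[symmetric] q_def[symmetric])
    qed
  qed
qed

section \<open>Passage to the limit in the Euler approximations\<close>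

theorem viable_solution_exists:
  assumes x0: "x0 \<in> X"
  obtains x where "x 0 = x0" "\<And>t. x t \<in> X" "\<And>B. \<exists>L. L-lipschitz_on {0..B} x"
    "\<And>t v. 0 \<le> t \<Longrightarrow> (x has_vector_derivative v) (at t) \<Longrightarrow> v \<in> F t (x t)"
proof -
  define \<epsilon> where "\<epsilon> k = inverse (real (Suc k))" for k
  have \<epsilon>: "0 < \<epsilon> k" "\<epsilon> k \<le> 1" for k by (simp_all add: \<epsilon>_def field_simps)
  have \<epsilon>_small: "\<exists>K. \<forall>k\<ge>K. \<epsilon> k \<le> e" if e: "0 < e" for e
  proof -
    obtain K where K: "\<epsilon> K < e" using reals_Archimedean[OF e] by (auto simp: \<epsilon>_def)
    have "\<epsilon> k \<le> e" if "K \<le> k" for k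
    proof -
      have "\<epsilon> k \<le> \<epsilon> K" using that by (simp add: \<epsilon>_def le_imp_inverse_le)
      then show ?thesis using K by simp
    qed
    then show ?thesis by blast
  qed
  \<comment> \<open>The horizon k grows while the mesh shrinks, so a single cluster point solves the
    inclusion on the whole half-line and nothing has to be glued.\<close>
  have "\<exists>y. y 0 = x0 \<and> euler_approximation (\<epsilon> k) (real k) y" for k
    using euler_approximation_exists[OF \<epsilon>(1) x0] by metis
  then obtain y where y0: "\<And>k. y k 0 = x0" and y: "\<And>k. euler_approximation (\<epsilon> k) (real k) (y k)"
    by metis
  have yX: "y k t \<in> X" for k t using y by (simp add: euler_approximation_def)
  \<comment> \<open>The approximations are Lipschitz up to an error proportional to the mesh.
    Velocities may be taken at a time later by \<open>\<epsilon> k \<le> 1\<close>, hence the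
    interval up to \<open>B + 1\<close>; the summand 2 leaves room for balls of radius
    \<open>2 * \<epsilon> k\<close>.\<close>
  define Lips where "Lips B L \<longleftrightarrow> 0 < L \<and> (\<forall>t\<in>{0..B + 1}. \<forall>x\<in>X. \<forall>v\<in>F t x. norm v + 2 \<le> L) \<and>
    (\<forall>k s t. 0 \<le> s \<longrightarrow> s \<le> t \<longrightarrow> t \<le> B \<longrightarrow> t \<le> real k \<longrightarrow> dist (y k t) (y k s) \<le> L * (t - s + \<epsilon> k))"
    for B L
  have "\<exists>L. Lips B L" for B
  proof -
    obtain M where M: "\<forall>t\<in>{0..B + 1}. \<forall>x\<in>X. \<forall>v\<in>F t x. norm v \<le> M"
      using bounded_F by blast
    define L where "L = max M 0 + 2"
    have bound: "norm v + 2 \<le> L" if "t \<in> {0..B + 1}" "x \<in> X" "v \<in> F t x" for t x v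
      using M that by (force simp: L_def)
    have "dist (y k t) (y k s) \<le> L * (t - s + \<epsilon> k)"
      if st: "0 \<le> s" "s \<le> t" "t \<le> B" "t \<le> real k" for k s t
    proof -
      have "\<exists>d c. \<bar>d - (t - s)\<bar> \<le> \<epsilon> k \<and> c \<in> cball 0 L \<and> y k t - y k s = d *\<^sub>R c"
      proof (rule euler_approximationD[OF y])
        fix r r' z v
        assume r: "0 \<le> r" "r \<le> t" "0 \<le> r'" "\<bar>r' - r\<bar> \<le> \<epsilon> k" and z: "z \<in> X" and v: "v \<in> F r' z"
        have "r' \<in> {0..B + 1}" using r st \<epsilon>(2)[of k] by auto
        then have "norm v + 2 \<le> L" using bound z v by blast
        then have "dist v 0 + 2 * \<epsilon> k \<le> L" using \<epsilon>(2)[of k] by (simp add: dist_norm)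
        then show "cball v (2 * \<epsilon> k) \<subseteq> cball 0 L" by (simp add: cball_subset_cball_iff)
      qed (use st in \<open>auto simp: L_def\<close>)
      then obtain d c where dc: "\<bar>d - (t - s)\<bar> \<le> \<epsilon> k" "norm c \<le> L" "y k t - y k s = d *\<^sub>R c"
        by auto
      have "norm (y k t - y k s) \<le> \<bar>d\<bar> * L" using dc by (simp add: mult_left_mono)
      also have "\<dots> \<le> (t - s + \<epsilon> k) * L" using dc st by (intro mult_right_mono) (auto simp: L_def)
      finally show ?thesis by (simp add: dist_norm mult.commute)
    qed
    moreover have "0 < L" by (simp add: L_def)
    ultimately show ?thesis using bound unfolding Lips_def by (intro exI[of _ L]) blast
  qed
  then obtain Lip where Lip: "\<And>B. Lips B (Lip B)" by metis
  have Lip_pos: "0 < Lip B" for B using Lip[of B] by (simp add: Lips_def)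
  have F_Lip: "norm v + 2 \<le> Lip B" if "0 \<le> t" "t \<le> B + 1" "x \<in> X" "v \<in> F t x" for B t x v
    using Lip[of B] that by (simp add: Lips_def)
  have y_Lip: "dist (y k t) (y k s) \<le> Lip B * (t - s + \<epsilon> k)"
    if "0 \<le> s" "s \<le> t" "t \<le> B" "t \<le> real k" for B k s t
    using Lip[of B] that by (simp add: Lips_def)
  have "\<exists>x. (\<forall>t. x t \<in> X) \<and>
    (\<forall>A e K. finite A \<longrightarrow> 0 < e \<longrightarrow> (\<exists>k\<ge>K. \<forall>t\<in>A. dist (y k t) (x t) < e))"
    by (rule pointwise_cluster_point[OF compact_X yX])
  then obtain x where xX: "\<And>t. x t \<in> X" and cluster:
    "\<forall>A e K. finite A \<longrightarrow> 0 < e \<longrightarrow> (\<exists>k\<ge>K. \<forall>t\<in>A. dist (y k t) (x t) < e)"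
    by blast
  have near: "\<exists>k. B \<le> real k \<and> \<epsilon> k \<le> e \<and> dist (y k s) (x s) < e \<and> dist (y k t) (x t) < e"
    if e: "0 < e" for B s t e
  proof -
    obtain K1 where K1: "\<forall>k\<ge>K1. \<epsilon> k \<le> e" using \<epsilon>_small[OF e] by blast
    obtain K2 where K2: "B \<le> real K2" using real_arch_simple by blast
    obtain k where "k \<ge> max K1 K2" "\<forall>r\<in>{s, t}. dist (y k r) (x r) < e"
      using cluster[rule_format, of "{s, t}" e "max K1 K2"] e by auto
    then show ?thesis using K1 K2 by (intro exI[of _ k]) auto
  qed
  have "dist (x 0) x0 \<le> e" if "0 < e" for e
    using near[OF that, of 0 0 0] y0 by (auto simp: dist_commute)
  then have x_0: "x 0 = x0"
    by (metis dist_le_zero_iff field_le_epsilon add_0)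
  have x_lip: "\<exists>L. L-lipschitz_on {0..B} x" for B
  proof -
    have le: "dist (x t) (x s) \<le> Lip B * (t - s)" if st: "0 \<le> s" "s \<le> t" "t \<le> B" for s t
    proof (rule field_le_epsilon)
      fix e :: real assume e: "0 < e"
      \<comment> \<open>Replacing x by \<open>y k\<close> at the two times costs
        \<open>2 * e'\<close>, and the mesh error costs at most \<open>Lip B * e'\<close>.\<close>
      define e' where "e' = e / (Lip B + 2)"
      have "(Lip B + 2) * e' = e" "0 < e'"
        using e Lip_pos[of B] by (simp_all add: e'_def)
      then have e': "0 < e'" "Lip B * e' + 2 * e' = e"
        by (simp_all add: algebra_simps)
      obtain k where k: "B \<le> real k" "\<epsilon> k \<le> e'" "dist (y k s) (x s) < e'" "dist (y k t) (x t) < e'"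
        using near[OF e'(1)] by blast
      have "dist (x t) (x s) \<le> dist (y k t) (x t) + dist (y k t) (y k s) + dist (y k s) (x s)"
        using dist_triangle[of "x t" "x s" "y k t"] dist_triangle[of "y k t" "x s" "y k s"]
        by (simp add: dist_commute)
      also have "\<dots> \<le> Lip B * (t - s + \<epsilon> k) + 2 * e'"
        using y_Lip[of s t B k] k st by auto
      also have "Lip B * (t - s + \<epsilon> k) \<le> Lip B * (t - s + e')"
        using k Lip_pos[of B] by simp
      finally show "dist (x t) (x s) \<le> Lip B * (t - s) + e"
        using e'(2) by (simp add: algebra_simps)
    qed
    have "(Lip B)-lipschitz_on {0..B} x"
    proof (rule lipschitz_onI)
      fix s t assume "s \<in> {0..B}" "t \<in> {0..B}"
      then show "dist (x s) (x t) \<le> Lip B * dist s t"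
        using le[of s t] le[of t s] by (cases "s \<le> t") (auto simp: dist_real_def dist_commute)
    qed (use Lip_pos[of B] in simp)
    then show ?thesis ..
  qed
  have x_incl: "v \<in> F t (x t)" if t: "0 \<le> t" and deriv: "(x has_vector_derivative v) (at t)" for t v
  proof -
    \<comment> \<open>The mean velocity c of an approximation over \<open>[t, t + h]\<close> is
      within 2 \<delta> of \<open>F t (x t)\<close>. Replacing the increment of x by h c costs
      \<delta> h, and replacing it by h v costs another \<delta> h, so c is within 2 \<delta> of
      v.\<close>
    have "\<exists>a\<in>F t (x t). dist a v \<le> 4 * \<delta>" if \<delta>: "0 < \<delta>" "\<delta> \<le> 1" for \<delta>
    proof -
      obtain \<eta> where \<eta>: "0 < \<eta>"
        "\<And>s y v. 0 \<le> s \<Longrightarrow> y \<in> X \<Longrightarrow> \<bar>s - t\<bar> \<le> \<eta> \<Longrightarrow> dist y (x t) \<le> \<eta> \<Longrightarrow> v \<in> F s y \<Longrightarrow>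
          \<exists>a\<in>F t (x t). dist v a \<le> \<delta>"
        using F_upper_semicontinuous[OF t xX \<delta>(1)] by blast
      define B where "B = t + 1"
      define L where "L = Lip B"
      have L: "0 < L" using Lip_pos by (simp add: L_def)
      \<comment> \<open>One \<delta> of the thickening is for upper semicontinuity, the other
        absorbs the balls of radius \<open>2 * \<epsilon> k\<close> around the nearby
        velocities.\<close>
      define C where "C = (\<Union>a\<in>F t (x t). \<Union>b\<in>cball 0 (2 * \<delta>). {a + b})"
      have "convex C"
        unfolding C_def by (intro convex_sums convex_F[OF t xX] convex_cball)
      have "C \<noteq> {}"
      proof -
        obtain a where a: "a \<in> F t (x t)" using viable_F[OF t xX] by blast
        have "a + 0 \<in> C"
          unfolding C_def using a \<delta> by (intro UN_I[of a] UN_I[of 0]) auto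
        then show ?thesis by blast
      qed
      have normC: "norm c \<le> L" if "c \<in> C" for c
      proof -
        obtain a b where ab: "c = a + b" "a \<in> F t (x t)" "norm b \<le> 2 * \<delta>"
          using \<open>c \<in> C\<close> by (auto simp: C_def)
        have "norm a + 2 \<le> L" using F_Lip[of t B "x t" a] t xX ab by (simp add: L_def B_def)
        then show ?thesis using norm_triangle_ineq[of a b] ab \<delta> by simp
      qed
      have "\<exists>k>0. \<forall>s. norm (s - t) < k \<longrightarrow> norm (x s - x t - (s - t) *\<^sub>R v) \<le> \<delta> * norm (s - t)"
        using deriv \<delta>(1) unfolding has_vector_derivative_def has_derivative_at_alt by blast
      then obtain \<kappa> where \<kappa>_pos: "0 < \<kappa>"
        and \<kappa>: "\<forall>s. norm (s - t) < \<kappa> \<longrightarrow> norm (x s - x t - (s - t) *\<^sub>R v) \<le> \<delta> * norm (s - t)"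
        by blast
      \<comment> \<open>The bound by \<kappa> makes the difference quotient accurate. The bound by
        \<eta> keeps the approximation within \<eta> of \<open>x t\<close> while it moves at speed
        at most L, and reserves half of \<eta> for the errors fixed next.\<close>
      define h where "h = min (min 1 (\<kappa> / 2)) (\<eta> / (2 * (1 + L)))"
      have h: "0 < h" "h \<le> 1" "h < \<kappa>" "h * (1 + L) \<le> \<eta> / 2"
      proof -
        show "0 < h" "h \<le> 1" "h < \<kappa>" using \<kappa>_pos \<eta>(1) L by (auto simp: h_def)
        have "h \<le> \<eta> / (2 * (1 + L))" by (simp add: h_def)
        then show "h * (1 + L) \<le> \<eta> / 2" using L by (simp add: field_simps)
      qed
      \<comment> \<open>e is chosen after h because the approximation error must be small relative
        to h: \<open>2 * e\<close> arises at the two ends of the interval and \<open>e * L\<close>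
        from \<open>d \<noteq> h\<close>, together at most \<open>\<delta> * h\<close>. The first
        bound pays for the mesh in the distance to \<open>(t, x t)\<close>, the second makes
        \<open>2 * \<epsilon> k \<le> \<delta>\<close>.\<close>
      define e where "e = min (min (\<eta> / (4 * (1 + L))) (\<delta> / 2)) (\<delta> * h / (2 + L))"
      have e: "0 < e" "2 * e * (1 + L) \<le> \<eta> / 2" "e \<le> \<delta> / 2" "e * (2 + L) \<le> \<delta> * h"
      proof -
        show "0 < e" using \<eta>(1) \<delta> h(1) L by (auto simp: e_def)
        show "e \<le> \<delta> / 2" unfolding e_def by (rule min.coboundedI1[OF min.cobounded2])
        have "e \<le> \<eta> / (4 * (1 + L))" "e \<le> \<delta> * h / (2 + L)" by (simp_all add: e_def)
        then show "2 * e * (1 + L) \<le> \<eta> / 2" "e * (2 + L) \<le> \<delta> * h"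
          using L by (simp_all add: field_simps)
      qed
      obtain k where k: "B \<le> real k" "\<epsilon> k \<le> e" "dist (y k t) (x t) < e" "dist (y k (t + h)) (x (t + h)) < e"
        using near[OF e(1)] by blast
      have "\<exists>d c. \<bar>d - (t + h - t)\<bar> \<le> \<epsilon> k \<and> c \<in> C \<and> y k (t + h) - y k t = d *\<^sub>R c"
      proof (rule euler_approximationD[OF y])
        fix r r' z v'
        assume r: "0 \<le> r" "t - \<epsilon> k \<le> r" "r \<le> t + h" "0 \<le> r'" "\<bar>r' - r\<bar> \<le> \<epsilon> k"
          and z: "z \<in> X" "dist z (y k r) \<le> \<epsilon> k" and v': "v' \<in> F r' z"
        have "dist (y k r) (y k t) \<le> L * (\<bar>r - t\<bar> + \<epsilon> k)"
        proof (cases "r \<le> t")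
          case True
          then show ?thesis
            using y_Lip[of r t B k] r t k by (simp add: L_def B_def dist_commute)
        next
          case False
          then show ?thesis
            using y_Lip[of t r B k] r t k h by (simp add: L_def B_def)
        qed
        also have "\<dots> \<le> L * (h + 2 * e)"
          using r k L h by (intro mult_left_mono) auto
        finally have "dist z (x t) \<le> L * (h + 2 * e) + 2 * e"
          using z k dist_triangle[of z "x t" "y k r"] dist_triangle[of "y k r" "x t" "y k t"] by linarith
        also have "\<dots> \<le> \<eta>" using e(2) h(1,4) by (simp add: algebra_simps)
        finally have *: "dist z (x t) \<le> \<eta>" .
        have "\<bar>r' - t\<bar> \<le> h + 2 * e" using r k h by auto
        also have "\<dots> \<le> \<eta>"
        proof -
          have "0 \<le> h * L" "0 \<le> e * L" using h e L by simp_all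
          then show ?thesis using e(2) h(4) by (simp add: algebra_simps)
        qed
        finally obtain a where a: "a \<in> F t (x t)" "dist v' a \<le> \<delta>"
          using \<eta>(2)[OF r(4) z(1) _ * v'] by blast
        show "cball v' (2 * \<epsilon> k) \<subseteq> C"
        proof
          fix b assume "b \<in> cball v' (2 * \<epsilon> k)"
          then have "norm (b - a) \<le> 2 * \<delta>"
            using a(2) k(2) e(3) dist_triangle[of a b v'] by (simp add: dist_norm norm_minus_commute)
          then show "b \<in> C"
            unfolding C_def using a(1) by (intro UN_I[of a] UN_I[of "b - a"]) auto
        qed
      qed (use t h k \<open>convex C\<close> \<open>C \<noteq> {}\<close> in \<open>auto simp: B_def\<close>)
      then obtain d c where "\<bar>d - (t + h - t)\<bar> \<le> \<epsilon> k" and c: "c \<in> C" "y k (t + h) - y k t = d *\<^sub>R c"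
        by blast
      then have dc: "\<bar>d - h\<bar> \<le> e" "c \<in> C" "y k (t + h) - y k t = d *\<^sub>R c"
        using k(2) by simp_all
      obtain a b where ab: "c = a + b" "a \<in> F t (x t)" "norm b \<le> 2 * \<delta>"
        using dc(2) by (auto simp: C_def)
      have "norm (x (t + h) - x t - h *\<^sub>R c) \<le> \<delta> * h"
      proof -
        have eq: "x (t + h) - x t - h *\<^sub>R c = (x (t + h) - y k (t + h)) + (y k t - x t) + (d - h) *\<^sub>R c"
          using dc(3) by (simp add: algebra_simps)
        have "norm (x (t + h) - x t - h *\<^sub>R c) \<le>
            norm (x (t + h) - y k (t + h)) + norm (y k t - x t) + norm ((d - h) *\<^sub>R c)"
          unfolding eq by (rule order_trans[OF norm_triangle_ineq add_right_mono[OF norm_triangle_ineq]])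
        moreover have "norm ((d - h) *\<^sub>R c) \<le> e * L"
          using dc(1) normC[OF dc(2)] e(1) by (simp add: mult_mono)
        moreover have "norm (x (t + h) - y k (t + h)) < e" "norm (y k t - x t) < e"
          using k(3,4) by (simp_all add: dist_norm norm_minus_commute)
        moreover have "2 * e + e * L \<le> \<delta> * h" using e(4) by (simp add: algebra_simps)
        ultimately show ?thesis by linarith
      qed
      moreover have "norm (x (t + h) - x t - h *\<^sub>R v) \<le> \<delta> * h"
        using \<kappa>[rule_format, of "t + h"] h(1,3) by simp
      moreover have "h *\<^sub>R (c - v) = (x (t + h) - x t - h *\<^sub>R v) - (x (t + h) - x t - h *\<^sub>R c)"
        by (simp add: algebra_simps)
      ultimately have "norm (h *\<^sub>R (c - v)) \<le> h * (2 * \<delta>)"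
        using norm_triangle_ineq4[of "x (t + h) - x t - h *\<^sub>R v" "x (t + h) - x t - h *\<^sub>R c"]
        by (simp add: algebra_simps)
      then have "norm (c - v) \<le> 2 * \<delta>"
        using h(1) by simp
      moreover have "a - v = (c - v) - b" using ab by simp
      ultimately have "dist a v \<le> 4 * \<delta>"
        using ab norm_triangle_ineq4[of "c - v" b] by (simp add: dist_norm)
      then show ?thesis using ab by blast
    qed
    note approx = this
    show ?thesis
    proof (rule closed_approachable[THEN iffD1, OF closed_F[OF t xX]], intro allI impI)
      fix e :: real assume e: "0 < e"
      define \<delta> where "\<delta> = min 1 (e / 5)"
      have "0 < \<delta>" "\<delta> \<le> 1" "4 * \<delta> < e" using e by (simp_all add: \<delta>_def min_def)
      with approx[of \<delta>] show "\<exists>a\<in>F t (x t). dist a v < e"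
        by (meson order_le_less_trans)
    qed
  qed
  show thesis by (rule that[OF x_0 xX x_lip x_incl])
qed

end

section \<open>Measurable selection of controls\<close>

text \<open>On a compact set the minimum of the absolute value is attained, so a zero exists iff a
  countable dense subset carries arbitrarily small values. That is a countable condition on
  t.\<close>

lemma sets_Collect_zero_Carath:
  fixes \<psi> :: "'a \<Rightarrow> 'b::euclidean_space \<Rightarrow> real"
  assumes C: "compact C" and meas: "\<And>u. u \<in> C \<Longrightarrow> (\<lambda>t. \<psi> t u) \<in> borel_measurable M"
    and cont: "\<And>t. t \<in> space M \<Longrightarrow> continuous_on C (\<psi> t)"
  shows "{t \<in> space M. \<exists>u\<in>C. \<psi> t u = 0} \<in> sets M"
proof -
  obtain D where D: "countable D" "D \<subseteq> C" "C \<subseteq> closure D"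
    using separable by blast
  have iff: "(\<exists>u\<in>C. \<psi> t u = 0) \<longleftrightarrow> (\<forall>n::nat. \<exists>d\<in>D. \<bar>\<psi> t d\<bar> < inverse (Suc n))"
    if t: "t \<in> space M" for t
  proof
    assume "\<exists>u\<in>C. \<psi> t u = 0"
    then obtain u where u: "u \<in> C" "\<psi> t u = 0" by blast
    show "\<forall>n::nat. \<exists>d\<in>D. \<bar>\<psi> t d\<bar> < inverse (Suc n)"
    proof
      fix n :: nat
      have "\<exists>\<delta>>0. \<forall>d\<in>C. dist d u < \<delta> \<longrightarrow> dist (\<psi> t d) (\<psi> t u) < inverse (Suc n)"
        using cont[OF t] u(1) unfolding continuous_on_iff by (metis inverse_positive_iff_positive of_nat_0_less_iff zero_less_Suc)
      then obtain \<delta> where \<delta>: "0 < \<delta>" "\<forall>d\<in>C. dist d u < \<delta> \<longrightarrow> dist (\<psi> t d) (\<psi> t u) < inverse (Suc n)"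
        by blast
      moreover obtain d where "d \<in> D" "dist d u < \<delta>"
        using D(3) u(1) \<delta>(1) by (meson closure_approachable subsetD)
      ultimately show "\<exists>d\<in>D. \<bar>\<psi> t d\<bar> < inverse (Suc n)"
        using D(2) u(2) by (auto simp: dist_real_def)
    qed
  next
    assume approx: "\<forall>n::nat. \<exists>d\<in>D. \<bar>\<psi> t d\<bar> < inverse (Suc n)"
    then have "C \<noteq> {}" using D(2) by blast
    then obtain u where u: "u \<in> C" "\<forall>d\<in>C. \<bar>\<psi> t u\<bar> \<le> \<bar>\<psi> t d\<bar>"
      using continuous_attains_inf[OF C, of "\<lambda>u. \<bar>\<psi> t u\<bar>"] cont[OF t] by (auto intro: continuous_on_rabs)
    have "\<psi> t u = 0"
    proof (rule ccontr)
      assume "\<psi> t u \<noteq> 0"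
      then obtain n where "inverse (real (Suc n)) < \<bar>\<psi> t u\<bar>"
        using reals_Archimedean[of "\<bar>\<psi> t u\<bar>"] by auto
      moreover obtain d where "d \<in> D" "\<bar>\<psi> t d\<bar> < inverse (real (Suc n))"
        using approx by blast
      ultimately show False using u(2) D(2) by force
    qed
    then show "\<exists>u\<in>C. \<psi> t u = 0" using u by blast
  qed
  have "{t \<in> space M. \<forall>n::nat. \<exists>d\<in>D. \<bar>\<psi> t d\<bar> < inverse (Suc n)} \<in> sets M"
  proof (intro sets.sets_Collect_countable_All sets.sets_Collect_countable_Ex' D(1))
    fix n :: nat and d assume "d \<in> D"
    then have [measurable]: "(\<lambda>t. \<psi> t d) \<in> borel_measurable M" using meas D(2) by blast
    show "{t \<in> space M. \<bar>\<psi> t d\<bar> < inverse (Suc n)} \<in> sets M" by measurable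
  qed
  moreover have "{t \<in> space M. \<exists>u\<in>C. \<psi> t u = 0} = {t \<in> space M. \<forall>n::nat. \<exists>d\<in>D. \<bar>\<psi> t d\<bar> < inverse (Suc n)}"
    using iff by blast
  ultimately show ?thesis by simp
qed

text \<open>Removing the sets of a countable basis one after the other, whenever this leaves something, cuts
  the compact set of zeros down to a single point.\<close>

lemma measurable_zero_selection:
  fixes \<psi> :: "'a \<Rightarrow> 'b::euclidean_space \<Rightarrow> real"
  assumes U: "compact U" and meas: "\<And>u. u \<in> U \<Longrightarrow> (\<lambda>t. \<psi> t u) \<in> borel_measurable M"
    and cont: "\<And>t. t \<in> space M \<Longrightarrow> continuous_on U (\<psi> t)"
    and ex: "\<And>t. t \<in> space M \<Longrightarrow> \<exists>u\<in>U. \<psi> t u = 0"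
  obtains u where "u \<in> borel_measurable M" "\<And>t. t \<in> space M \<Longrightarrow> u t \<in> U \<and> \<psi> t (u t) = 0"
proof -
  obtain \<B> :: "'b set set" where \<B>: "countable \<B>" "topological_basis \<B>"
    using ex_countable_basis by blast
  then have "\<B> \<noteq> {}" using topological_basisE[of \<B> UNIV] by blast
  define G where "G = from_nat_into \<B>"
  have range_G: "range G = \<B>" using \<B>(1) \<open>\<B> \<noteq> {}\<close> by (simp add: G_def range_from_nat_into)
  then have open_G: "open (G n)" for n using \<B>(2) topological_basis_open by blast
  have separate: "\<exists>n. a \<in> G n \<and> b \<notin> G n" if "a \<noteq> b" for a b
  proof -
    have "open (- {b})" "a \<in> - {b}" using that by auto
    then obtain B where "B \<in> \<B>" "a \<in> B" "B \<subseteq> - {b}"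
      using topological_basisE[OF \<B>(2)] by metis
    then show ?thesis using range_G by blast
  qed
  define K where "K = rec_nat (\<lambda>t. {u\<in>U. \<psi> t u = 0})
    (\<lambda>n k t. if k t - G n \<noteq> {} then k t - G n else k t)"
  have K_0: "K 0 t = {u\<in>U. \<psi> t u = 0}"
    and K_Suc: "K (Suc n) t = (if K n t - G n \<noteq> {} then K n t - G n else K n t)" for n t
    by (simp_all add: K_def)
  have K: "compact (K n t) \<and> K n t \<noteq> {} \<and> K n t \<subseteq> K 0 t" if t: "t \<in> space M" for n t
  proof (induction n)
    case 0
    have "{u\<in>U. \<psi> t u = 0} = U \<inter> \<psi> t -` {0}" by auto
    moreover have "closed (U \<inter> \<psi> t -` {0})"
      by (rule continuous_closed_preimage[OF cont[OF t] compact_imp_closed[OF U]]) simp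
    ultimately have "compact (K 0 t)"
      using compact_Int_closed[OF U, of "U \<inter> \<psi> t -` {0}"] by (simp add: K_0)
    then show ?case using ex[OF t] by (auto simp: K_0)
  next
    case (Suc n)
    then show ?case by (auto simp: K_Suc open_G compact_diff)
  qed
  have K_anti: "K n t \<subseteq> K m t" if "m \<le> n" for m n t
    using that by (induction n rule: dec_induct) (auto simp: K_Suc)
  have K_meas: "{t \<in> space M. K n t \<inter> C \<noteq> {}} \<in> sets M" if "closed C" for n C
    using that
  proof (induction n arbitrary: C)
    case (0 C)
    have "{t \<in> space M. K 0 t \<inter> C \<noteq> {}} = {t \<in> space M. \<exists>u\<in>U \<inter> C. \<psi> t u = 0}"
      by (auto simp: K_0)
    moreover have "{t \<in> space M. \<exists>u\<in>U \<inter> C. \<psi> t u = 0} \<in> sets M"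
      using 0 by (intro sets_Collect_zero_Carath compact_Int_closed U meas continuous_on_subset[OF cont]) auto
    ultimately show ?case by simp
  next
    case (Suc n C)
    have [measurable]: "{t \<in> space M. K n t \<inter> - G n \<noteq> {}} \<in> sets M"
      "{t \<in> space M. K n t \<inter> (C \<inter> - G n) \<noteq> {}} \<in> sets M" "{t \<in> space M. K n t \<inter> C \<noteq> {}} \<in> sets M"
      using Suc.prems open_G by (auto intro!: Suc.IH)
    \<comment> \<open>Either something outside \<open>G n\<close> is left and must meet C, or
      \<open>K n t\<close> lies inside \<open>G n\<close>, is kept unchanged, and must itself meet
      C.\<close>
    have "{t \<in> space M. K (Suc n) t \<inter> C \<noteq> {}} =
      {t \<in> space M. K n t \<inter> (C \<inter> - G n) \<noteq> {}} \<union>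
      ({t \<in> space M. K n t \<inter> C \<noteq> {}} - {t \<in> space M. K n t \<inter> - G n \<noteq> {}})"
      by (auto simp: K_Suc split: if_splits)
    then show ?case by simp
  qed
  have nest: "(\<Inter>n. K n t \<inter> C) \<noteq> {}" if "t \<in> space M" "closed C" "\<And>n. K n t \<inter> C \<noteq> {}" for t C
    using that K K_anti[THEN subsetD] by (intro compact_nest) (auto intro: compact_Int_closed)
  have "\<exists>a. (\<Inter>n. K n t) = {a}" if t: "t \<in> space M" for t
  proof -
    have "(\<Inter>n. K n t) \<noteq> {}" using nest[OF t closed_UNIV] K[OF t] by simp
    then obtain a where a: "\<And>n. a \<in> K n t" by blast
    have "b = a" if b: "\<forall>n. b \<in> K n t" for b
    proof (rule ccontr)
      assume "b \<noteq> a"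
      \<comment> \<open>As a survives the removal of \<open>G n\<close>, the removal does take place
        at stage n and deletes b.\<close>
      then obtain n where "b \<in> G n" "a \<notin> G n" using separate by blast
      then show False using a[of n] b[rule_format, of "Suc n"] by (auto simp: K_Suc split: if_splits)
    qed
    then have "(\<Inter>n. K n t) \<subseteq> {a}" by blast
    moreover have "{a} \<subseteq> (\<Inter>n. K n t)" using a by simp
    ultimately show ?thesis by blast
  qed
  then obtain u where u: "\<And>t. t \<in> space M \<Longrightarrow> (\<Inter>n. K n t) = {u t}" by metis
  show thesis
  proof (rule that)
    show "u t \<in> U \<and> \<psi> t (u t) = 0" if "t \<in> space M" for t
      using u[OF that] K_0[of t] by blast
    have "{t \<in> space M. u t \<in> C} \<in> sets M" if C: "closed C" for C
    proof -
      \<comment> \<open>If every \<open>K n t\<close> meets the closed set C, then by nested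
        compactness so does their intersection, the single point \<open>u t\<close>. Measurability
        of u thus reduces to \<open>K_meas\<close>.\<close>
      have "u t \<in> C \<longleftrightarrow> (\<forall>n. K n t \<inter> C \<noteq> {})" if t: "t \<in> space M" for t
        using u[OF t] nest[OF t C] by blast
      then have "{t \<in> space M. u t \<in> C} = {t \<in> space M. \<forall>n. K n t \<inter> C \<noteq> {}}" by blast
      also have "\<dots> \<in> sets M" by (intro sets.sets_Collect_countable_All K_meas C)
      finally show ?thesis .
    qed
    then have "space M - {t \<in> space M. u t \<in> - S} \<in> sets M" if "open S" for S
      using that by (meson sets.compl_sets closed_Compl)
    moreover have "u -` S \<inter> space M = space M - {t \<in> space M. u t \<in> - S}" for S by auto
    ultimately show "u \<in> borel_measurable M" by (intro borel_measurableI) simp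
  qed
qed

section \<open>Lipschitz curves, their velocities and controls\<close>

lemma lipschitz_imp_absolutely_continuous_on:
  assumes x: "L-lipschitz_on {a..b} x"
  shows "absolutely_continuous_on a b x"
  unfolding absolutely_continuous_on_def
proof (intro allI impI)
  fix \<epsilon> :: real assume \<epsilon>: "0 < \<epsilon>"
  have L: "0 \<le> L" using x by (rule lipschitz_on_nonneg)
  have "(\<Sum>i<N. norm (x (r i) - x (l i))) < \<epsilon>"
    if lr: "\<forall>i<N. a \<le> l i \<and> l i \<le> r i \<and> r i \<le> b" and small: "(\<Sum>i<N. r i - l i) < \<epsilon> / (L + 1)"
    for N :: nat and l r
  proof -
    have "(\<Sum>i<N. norm (x (r i) - x (l i))) \<le> (\<Sum>i<N. L * (r i - l i))"
    proof (rule sum_mono)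
      fix i assume "i \<in> {..<N}"
      then have i: "a \<le> l i" "l i \<le> r i" "r i \<le> b" using lr by auto
      then have "r i \<in> {a..b}" "l i \<in> {a..b}" by auto
      from lipschitz_onD[OF x this] show "norm (x (r i) - x (l i)) \<le> L * (r i - l i)"
        using i by (simp add: dist_norm)
    qed
    also have "\<dots> \<le> (L + 1) * (\<Sum>i<N. r i - l i)"
      unfolding sum_distrib_left[symmetric] using lr by (intro mult_right_mono sum_nonneg) auto
    also have "\<dots> < \<epsilon>" using small L by (simp add: field_simps)
    finally show ?thesis .
  qed
  then show "\<exists>\<delta>>0. \<forall>(N::nat) l r.
        (\<forall>i<N. a \<le> l i \<and> l i \<le> r i \<and> r i \<le> b) \<and>
        (\<forall>i<N. \<forall>j<N. i \<noteq> j \<longrightarrow> {l i<..<r i} \<inter> {l j<..<r j} = {}) \<and>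
        (\<Sum>i<N. r i - l i) < \<delta> \<longrightarrow>
        (\<Sum>i<N. norm (x (r i) - x (l i))) < \<epsilon>"
    using \<epsilon> L by (intro exI[of _ "\<epsilon> / (L + 1)"]) auto
qed

lemma locally_lipschitz_AE_differentiable:
  fixes x :: "real \<Rightarrow> 'a::euclidean_space"
  assumes x: "\<And>B. \<exists>L. L-lipschitz_on {0..B} x"
  shows "AE t in lebesgue_on {0..}. \<exists>v. (x has_vector_derivative v) (at t)"
proof -
  have "AE t in lebesgue. 0 < t \<longrightarrow> t < real n \<longrightarrow> (\<exists>v. (x has_vector_derivative v) (at t))" for n
  proof -
    \<comment> \<open>Composition with the projection onto \<open>[0, n]\<close> makes x globally
      Lipschitz and leaves it unchanged near every interior point.\<close>
    define clamp where "clamp t = max 0 (min (real n) t)" for t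
    obtain L where L: "L-lipschitz_on {0..real n} x" using x by blast
    have "L-lipschitz_on UNIV (\<lambda>t. x (clamp t))"
    proof (rule lipschitz_onI)
      fix s t :: real
      have "dist (x (clamp s)) (x (clamp t)) \<le> L * dist (clamp s) (clamp t)"
        by (rule lipschitz_onD[OF L]) (auto simp: clamp_def)
      also have "\<dots> \<le> L * dist s t"
        using lipschitz_on_nonneg[OF L] by (intro mult_left_mono) (auto simp: clamp_def dist_real_def)
      finally show "dist (x (clamp s)) (x (clamp t)) \<le> L * dist s t" .
    qed (rule lipschitz_on_nonneg[OF L])
    from lipschitz_AE_differentiable[OF this] show ?thesis
    proof (rule eventually_mono, intro impI)
      fix t assume "\<exists>v. ((\<lambda>t. x (clamp t)) has_vector_derivative v) (at t)" and t: "0 < t" "t < real n"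
      then obtain v where "((\<lambda>t. x (clamp t)) has_vector_derivative v) (at t)" by blast
      then have "(x has_vector_derivative v) (at t)"
        by (rule has_vector_derivative_transform_within_open[where S = "{0<..<real n}"])
          (use t in \<open>auto simp: clamp_def\<close>)
      then show "\<exists>v. (x has_vector_derivative v) (at t)" ..
    qed
  qed
  then have "AE t in lebesgue. \<forall>n. 0 < t \<longrightarrow> t < real n \<longrightarrow> (\<exists>v. (x has_vector_derivative v) (at t))"
    unfolding AE_all_countable by blast
  \<comment> \<open>Nothing is known about x to the left of 0, so a two-sided derivative at 0 cannot
    be expected.\<close>
  moreover have "AE t in lebesgue. t \<noteq> (0::real)"
    by (rule AE_I'[of "{0}"]) (auto simp: negligible_iff_null_sets[symmetric])
  ultimately have "AE t in lebesgue. t \<in> {0..} \<longrightarrow> (\<exists>v. (x has_vector_derivative v) (at t))"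
  proof eventually_elim
    case (elim t)
    obtain n where "t < real n" using reals_Archimedean2 by blast
    then show ?case using elim by auto
  qed
  then show ?thesis
    by (simp add: AE_restrict_space_iff)
qed

text \<open>A limit of difference quotients is measurable. Forward steps stay in the half-line where
  x is continuous, and \<open>lim\<close> has some value even where the quotients diverge, so v is
  measurable as a total function.\<close>

lemma measurable_velocity:
  fixes x :: "real \<Rightarrow> 'a::euclidean_space"
  assumes x: "continuous_on {0..} x"
  obtains v where "v \<in> borel_measurable (lebesgue_on {0..})"
    "\<And>t w. (x has_vector_derivative w) (at t) \<Longrightarrow> v t = w"
proof -
  define q where "q n t = (x (t + inverse (real (Suc n))) - x t) /\<^sub>R inverse (real (Suc n))" for n t
  have "q n \<in> borel_measurable (lebesgue_on {0..})" for n
    unfolding q_def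
    by (intro continuous_imp_measurable_on_sets_lebesgue continuous_intros continuous_on_compose2[OF x])
      (auto simp: add_nonneg_nonneg)
  then have "(\<lambda>t. lim (\<lambda>n. q n t)) \<in> borel_measurable (lebesgue_on {0..})"
    by (rule borel_measurable_lim_metric)
  moreover have "lim (\<lambda>n. q n t) = w" if w: "(x has_vector_derivative w) (at t)" for t w
  proof -
    have "((\<lambda>h. (x (t + h) - x t) /\<^sub>R h) \<longlongrightarrow> w) (at 0)"
    proof (rule LIM_zero_cancel, rule tendsto_norm_zero_cancel, rule Lim_transform_eventually)
      show "((\<lambda>h. norm (x (t + h) - x t - h *\<^sub>R w) / norm h) \<longlongrightarrow> 0) (at 0)"
        using w by (simp add: has_vector_derivative_def has_derivative_at)
      have "norm (x (t + h) - x t - h *\<^sub>R w) / norm h = norm ((x (t + h) - x t) /\<^sub>R h - w)"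
        if "h \<noteq> 0" for h
      proof -
        have "(x (t + h) - x t) /\<^sub>R h - w = (x (t + h) - x t - h *\<^sub>R w) /\<^sub>R h"
          using that by (simp add: scaleR_diff_right)
        then show ?thesis by (simp add: divide_inverse mult.commute)
      qed
      then show "\<forall>\<^sub>F h in at 0. norm (x (t + h) - x t - h *\<^sub>R w) / norm h =
          norm ((x (t + h) - x t) /\<^sub>R h - w)"
        by (simp add: eventually_at_filter)
    qed
    moreover have "filterlim (\<lambda>n. inverse (real (Suc n))) (at 0) sequentially"
      by (auto simp: filterlim_at LIMSEQ_inverse_real_of_nat simp del: of_nat_Suc)
    ultimately have "(\<lambda>n. q n t) \<longlonglongrightarrow> w"
      unfolding q_def by (rule filterlim_compose)
    then show ?thesis by (rule limI)
  qed
  ultimately show thesis by (rule that)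
qed

text \<open>This is Filippov's lemma. The selection is made in the fixed compact set U, not in the
  minimising controls, so the constraint set does not vary with t.\<close>

lemma measurable_control_selection:
  fixes f :: "real \<times> 'a::euclidean_space \<times> 'b::euclidean_space \<Rightarrow> 'a"
  assumes U: "compact U" "U \<noteq> {}" and f: "continuous_on UNIV f" and x: "continuous_on {0..} x"
    and v: "v \<in> borel_measurable (lebesgue_on {0..})"
    and sol: "AE t in lebesgue_on {0..}. v t \<in> (\<lambda>u. f (t, x t, u)) ` U"
  obtains u where "u \<in> borel_measurable (lebesgue_on {0..})" "\<And>t. 0 \<le> t \<Longrightarrow> u t \<in> U"
    "AE t in lebesgue_on {0..}. f (t, x t, u t) = v t"
proof -
  let ?M = "lebesgue_on {0::real..}"
  obtain N where N: "{t \<in> space ?M. \<not> v t \<in> (\<lambda>u. f (t, x t, u)) ` U} \<subseteq> N" "N \<in> null_sets ?M"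
    using sol by (rule AE_E) (auto simp: null_sets_def)
  have Nset [measurable]: "N \<in> sets ?M" using N(2) by auto
  \<comment> \<open>On the exceptional null set every control counts as a zero; the selected u then
    takes values in U at all times, not just almost all.\<close>
  define \<psi> where "\<psi> t u = (if t \<in> N then 0 else norm (f (t, x t, u) - v t))" for t u
  obtain u where u: "u \<in> borel_measurable ?M"
    "\<And>t. t \<in> space ?M \<Longrightarrow> u t \<in> U \<and> \<psi> t (u t) = 0"
  proof (rule measurable_zero_selection[OF U(1)])
    fix a
    have "continuous_on {0..} (\<lambda>t. f (t, x t, a))"
      by (intro continuous_on_compose2[OF f] continuous_intros x) auto
    then have [measurable]: "(\<lambda>t. f (t, x t, a)) \<in> borel_measurable ?M"
      by (rule continuous_imp_measurable_on_sets_lebesgue) simp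
    note v[measurable]
    show "(\<lambda>t. \<psi> t a) \<in> borel_measurable ?M"
      unfolding \<psi>_def by measurable
  next
    fix t
    have "continuous_on U (\<lambda>u. f (t, x t, u))"
      by (intro continuous_on_compose2[OF f] continuous_intros) auto
    then show "continuous_on U (\<psi> t)"
      by (cases "t \<in> N") (auto simp: \<psi>_def intro!: continuous_intros)
  next
    fix t assume t: "t \<in> space ?M"
    show "\<exists>u\<in>U. \<psi> t u = 0"
    proof (cases "t \<in> N")
      case True
      then show ?thesis using U(2) by (auto simp: \<psi>_def)
    next
      case False
      then have "v t \<in> (\<lambda>u. f (t, x t, u)) ` U" using N(1) t by blast
      then obtain a where "a \<in> U" "v t = f (t, x t, a)" by blast
      then show ?thesis using False by (intro bexI[of _ a]) (simp_all add: \<psi>_def)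
    qed
  qed blast
  show thesis
  proof (rule that[OF u(1)])
    show "u t \<in> U" if "0 \<le> t" for t using u(2) that by (simp add: space_restrict_space)
    show "AE t in ?M. f (t, x t, u t) = v t"
    proof (rule AE_I'[OF N(2)], rule subsetI, rule ccontr)
      fix t assume "t \<in> {t \<in> space ?M. f (t, x t, u t) \<noteq> v t}" "t \<notin> N"
      then show False using u(2)[of t] by (simp add: \<psi>_def)
    qed
  qed
qed

section \<open>Minimising controls\<close>

text \<open>Uniqueness of gradients gives the description by \<open>THE\<close> a value, and the
  chain rule along \<open>y \<mapsto> (t, y)\<close> identifies it. Continuity of
  \<open>grad_x\<close> in \<open>(t, x)\<close> is then inherited from the full gradient.\<close>

lemma grad_x_eq:
  assumes "GDERIV V (t, x) :> g"
  shows "grad_x V t x = snd g"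
proof -
  have "((\<lambda>y. (t, y)) has_derivative (\<lambda>h. (0, h))) (at x)"
    by (auto intro!: derivative_eq_intros)
  from diff_chain_at[OF this assms[unfolded gderiv_def]]
  have "((\<lambda>y. V (t, y)) has_derivative (\<lambda>h. h \<bullet> snd g)) (at x)"
    by (simp add: o_def inner_prod_def)
  then have d: "GDERIV (\<lambda>y. V (t, y)) x :> snd g" by (simp add: gderiv_def)
  moreover have "g' = snd g" if "GDERIV (\<lambda>y. V (t, y)) x :> g'" for g'
    using has_derivative_unique[OF that[unfolded gderiv_def] d[unfolded gderiv_def]]
    by (metis vector_eq_ldot)
  ultimately show ?thesis unfolding grad_x_def by (rule the_equality)
qed

lemma mem_argmin_controls:
  "u \<in> argmin_controls f U V t x \<longleftrightarrow>
    u \<in> U \<and> (\<forall>w\<in>U. grad_x V t x \<bullet> f (t, x, u) \<le> grad_x V t x \<bullet> f (t, x, w))"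
  by (auto simp: argmin_controls_def is_arg_min_def not_less)

text \<open>In terms of velocities, minimality is membership in one half-space per competitor q. The
  set of minimising controls itself may fail to be convex.\<close>

lemma convex_argmin_velocities:
  assumes "convex ((\<lambda>u. f (t, x, u)) ` U)"
  shows "convex ((\<lambda>u. f (t, x, u)) ` argmin_controls f U V t x)"
proof -
  let ?S = "(\<lambda>u. f (t, x, u)) ` U" and ?g = "grad_x V t x"
  have "(\<lambda>u. f (t, x, u)) ` argmin_controls f U V t x = ?S \<inter> (\<Inter>q\<in>?S. {p. ?g \<bullet> p \<le> ?g \<bullet> q})"
    by (auto simp: mem_argmin_controls)
  also have "convex \<dots>"
    by (intro convex_Int convex_INT assms convex_halfspace_le)
  finally show ?thesis .
qed

text \<open>The controls behind convergent velocities need not converge, but they have a convergent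
  subsequence in U. Along it, the inequality against each fixed competitor w passes to the
  limit.\<close>

lemma closed_graph_argmin_velocities:
  assumes f: "continuous_on UNIV f" and U: "compact U" and X: "closed X"
    and grad: "continuous_on UNIV (\<lambda>(t, x). grad_x V t x)"
  shows "closed {(t, x, v). 0 \<le> t \<and> x \<in> X \<and> v \<in> (\<lambda>u. f (t, x, u)) ` argmin_controls f U V t x}"
  unfolding closed_sequential_limits
proof (intro allI impI, elim conjE)
  fix p l
  assume p: "\<forall>n. p n \<in> {(t, x, v). 0 \<le> t \<and> x \<in> X \<and> v \<in> (\<lambda>u. f (t, x, u)) ` argmin_controls f U V t x}"
    and pl: "p \<longlonglongrightarrow> l"
  define t where "t n = fst (p n)" for n
  define x where "x n = fst (snd (p n))" for n
  obtain t' x' v' where l: "l = (t', x', v')" by (cases l)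
  have t: "t \<longlonglongrightarrow> t'" and x: "x \<longlonglongrightarrow> x'" and v: "(\<lambda>n. snd (snd (p n))) \<longlonglongrightarrow> v'"
    using tendsto_fst[OF pl] tendsto_fst[OF tendsto_snd[OF pl]] tendsto_snd[OF tendsto_snd[OF pl]]
    by (simp_all add: l t_def[abs_def] x_def[abs_def])
  have tx: "0 \<le> t n" "x n \<in> X" for n
    using p[rule_format, of n] by (auto simp: t_def x_def)
  have "\<exists>u. u \<in> argmin_controls f U V (t n) (x n) \<and> snd (snd (p n)) = f (t n, x n, u)" for n
    using p[rule_format, of n] by (auto simp: t_def x_def)
  then obtain u where u: "\<And>n. u n \<in> argmin_controls f U V (t n) (x n)"
    and pu: "\<And>n. snd (snd (p n)) = f (t n, x n, u n)" by metis
  have "\<forall>n. u n \<in> U" using u by (simp add: mem_argmin_controls)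
  then obtain u' r where u': "u' \<in> U" and r: "strict_mono r" and ur: "(u \<circ> r) \<longlonglongrightarrow> u'"
    by (rule seq_compactE[OF compact_imp_seq_compact[OF U]])
  have tr: "(t \<circ> r) \<longlonglongrightarrow> t'" and xr: "(x \<circ> r) \<longlonglongrightarrow> x'"
    by (rule LIMSEQ_subseq_LIMSEQ[OF t r], rule LIMSEQ_subseq_LIMSEQ[OF x r])
  have lim_f: "(\<lambda>n. f ((t \<circ> r) n, (x \<circ> r) n, w n)) \<longlonglongrightarrow> f (t', x', w')" if "w \<longlonglongrightarrow> w'" for w w'
    using continuous_on_tendsto_compose[OF f tendsto_Pair[OF tr tendsto_Pair[OF xr that]]] by simp
  have lim_g: "(\<lambda>n. grad_x V ((t \<circ> r) n) ((x \<circ> r) n)) \<longlonglongrightarrow> grad_x V t' x'"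
    using continuous_on_tendsto_compose[OF grad tendsto_Pair[OF tr xr]] by simp
  have "v' = f (t', x', u')"
  proof (rule LIMSEQ_unique)
    show "((\<lambda>n. snd (snd (p n))) \<circ> r) \<longlonglongrightarrow> v'" using v r by (rule LIMSEQ_subseq_LIMSEQ)
    show "((\<lambda>n. snd (snd (p n))) \<circ> r) \<longlonglongrightarrow> f (t', x', u')"
      using lim_f[OF ur] by (simp add: o_def pu)
  qed
  moreover have "grad_x V t' x' \<bullet> f (t', x', u') \<le> grad_x V t' x' \<bullet> f (t', x', w)" if "w \<in> U" for w
  proof (rule LIMSEQ_le[OF tendsto_inner[OF lim_g lim_f[OF ur]] tendsto_inner[OF lim_g lim_f[OF tendsto_const]]])
    show "\<exists>N. \<forall>n\<ge>N. grad_x V ((t \<circ> r) n) ((x \<circ> r) n) \<bullet> f ((t \<circ> r) n, (x \<circ> r) n, (u \<circ> r) n)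
        \<le> grad_x V ((t \<circ> r) n) ((x \<circ> r) n) \<bullet> f ((t \<circ> r) n, (x \<circ> r) n, w)"
      using u that by (auto simp: mem_argmin_controls)
  qed
  moreover have "0 \<le> t'"
    using tx(1) by (intro LIMSEQ_le_const[OF t]) simp
  moreover have "x' \<in> X"
    using tx(2) by (intro closed_sequentially[OF X _ x]) simp
  ultimately show "l \<in> {(t, x, v). 0 \<le> t \<and> x \<in> X \<and> v \<in> (\<lambda>u. f (t, x, u)) ` argmin_controls f U V t x}"
    using u' by (auto simp: l mem_argmin_controls)
qed

text \<open>The trajectory has to exist on the whole half-line, and the averaging of velocities uses
  convexity at every time. Therefore \<open>convex_after_horizon\<close> is assumed in addition to
  the convexity on \<open>[0, T]\<close> of the informal statement.\<close>

theorem theorem4p2: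
  fixes f :: "real \<times> (real^'n) \<times> (real^'m) \<Rightarrow> real^'n"
    and U :: "(real^'m) set" and X K :: "(real^'n) set"
    and T :: real and x0 :: "real^'n"
    and V :: "real \<times> (real^'n) \<Rightarrow> real"
  assumes T_nonneg: "T \<ge> 0"
    and f_lipschitz: "\<exists>L. L-lipschitz_on UNIV f"
    and U_compact: "compact U" and X_compact: "compact X"
    and K_compact: "compact K" and K_subset: "K \<subseteq> X" and x0_in: "x0 \<in> X"
    and convex_up_to_horizon: "\<forall>t\<in>{0..T}. \<forall>x\<in>X. convex ((\<lambda>u. f (t, x, u)) ` U)"
    and convex_after_horizon: "\<forall>t>T. \<forall>x\<in>X. convex ((\<lambda>u. f (t, x, u)) ` U)"
    and admissible: "\<exists>t1\<in>{0..T}. \<exists>u. u \<in> admissible_controls f U X K 0 t1 x0"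
    and V_C1: "C1_function V"
    and viable: "\<forall>t\<ge>0. \<forall>x\<in>X. viable_argmin_controls f U X V t x \<noteq> {}"
  shows "\<exists>x\<^sub>V u\<^sub>V. trajectory U x0 x\<^sub>V u\<^sub>V \<and>
    (AE t in lebesgue_on {0..}.
       (x\<^sub>V has_vector_derivative f (t, x\<^sub>V t, u\<^sub>V t)) (at t) \<and>
       u\<^sub>V t \<in> argmin_controls f U V t (x\<^sub>V t)) \<and>
    (AE t in lebesgue_on {0..}. x\<^sub>V t \<in> X)"
proof -
  define F where "F t x = (\<lambda>u. f (t, x, u)) ` argmin_controls f U V t x" for t x
  have f: "continuous_on UNIV f"
    using f_lipschitz lipschitz_on_continuous_on by blast
  obtain G where "\<And>z. GDERIV V z :> G z" and G: "continuous_on UNIV G"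
    using V_C1 by (auto simp: C1_function_def)
  then have "(\<lambda>(t, x). grad_x V t x) = (\<lambda>z. snd (G z))"
    by (auto simp: fun_eq_iff intro: grad_x_eq)
  then have grad: "continuous_on UNIV (\<lambda>(t, x). grad_x V t x)"
    using G by (simp add: continuous_on_snd)
  interpret viable_inclusion F X
  proof
    show "compact X" by fact
    show "convex (F t x)" if "0 \<le> t" "x \<in> X" for t x
      unfolding F_def using convex_up_to_horizon convex_after_horizon that
      by (intro convex_argmin_velocities) (metis atLeastAtMost_iff not_le)
    show "closed {(t, x, v). 0 \<le> t \<and> x \<in> X \<and> v \<in> F t x}"
      unfolding F_def
      by (rule closed_graph_argmin_velocities[OF f U_compact compact_imp_closed[OF X_compact] grad])
    show "\<exists>M. \<forall>t\<in>{0..B}. \<forall>x\<in>X. \<forall>v\<in>F t x. norm v \<le> M" for B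
    proof -
      have "compact (f ` ({0..B} \<times> X \<times> U))"
        by (intro compact_continuous_image continuous_on_subset[OF f] compact_Times U_compact X_compact) auto
      then obtain M where "\<forall>v\<in>f ` ({0..B} \<times> X \<times> U). norm v \<le> M"
        using compact_imp_bounded bounded_iff by blast
      then show ?thesis by (intro exI[of _ M]) (auto simp: F_def mem_argmin_controls)
    qed
    show "F t x \<inter> contingent_cone X x \<noteq> {}" if "0 \<le> t" "x \<in> X" for t x
      using viable that by (fastforce simp: F_def viable_argmin_controls_def)
  qed
  obtain x where x0: "x 0 = x0" and xX: "\<And>t. x t \<in> X" and lip: "\<And>B. \<exists>L. L-lipschitz_on {0..B} x"
    and inclusion: "\<And>t v. 0 \<le> t \<Longrightarrow> (x has_vector_derivative v) (at t) \<Longrightarrow> v \<in> F t (x t)"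
    using viable_solution_exists[OF x0_in] by blast
  have x: "continuous_on {0..} x"
    unfolding continuous_on_eq_continuous_within
  proof
    fix t :: real assume t: "t \<in> {0..}"
    have "continuous_on {0..t + 1} x" using lip lipschitz_on_continuous_on by blast
    then have "continuous (at t within {0..t + 1}) x" using t by (simp add: continuous_on_eq_continuous_within)
    moreover have "at t within {0..t + 1} = at t within {0..}"
      using t by (intro at_within_nhd[of t "{..<t + 1}"]) auto
    ultimately show "continuous (at t within {0..}) x" by simp
  qed
  obtain v where v: "v \<in> borel_measurable (lebesgue_on {0..})"
    "\<And>t w. (x has_vector_derivative w) (at t) \<Longrightarrow> v t = w"
    using measurable_velocity[OF x] by blast
  have deriv: "AE t in lebesgue_on {0..}. (x has_vector_derivative v t) (at t) \<and> v t \<in> F t (x t)"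
    using locally_lipschitz_AE_differentiable[OF lip] AE_space
    by eventually_elim (use v(2) inclusion in \<open>force\<close>)
  then have "AE t in lebesgue_on {0..}. v t \<in> (\<lambda>u. f (t, x t, u)) ` U"
    by eventually_elim (auto simp: F_def mem_argmin_controls)
  moreover have "U \<noteq> {}"
    using viable x0_in by (force simp: viable_argmin_controls_def mem_argmin_controls)
  ultimately obtain u where u: "u \<in> borel_measurable (lebesgue_on {0..})" "\<And>t. 0 \<le> t \<Longrightarrow> u t \<in> U"
    and fu: "AE t in lebesgue_on {0..}. f (t, x t, u t) = v t"
    using measurable_control_selection[OF U_compact _ f x v(1)] by blast
  have "trajectory U x0 x u"
    unfolding trajectory_def
  proof (intro conjI allI impI)
    fix a b :: real assume ab: "0 \<le> a \<and> a \<le> b"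
    obtain L where "L-lipschitz_on {0..b} x" using lip by blast
    then have "L-lipschitz_on {a..b} x" using ab by (auto intro: lipschitz_on_subset)
    then show "absolutely_continuous_on a b x" by (rule lipschitz_imp_absolutely_continuous_on)
  qed (use x0 u in auto)
  moreover have "AE t in lebesgue_on {0..}. (x has_vector_derivative f (t, x t, u t)) (at t) \<and>
      u t \<in> argmin_controls f U V t (x t)"
    using deriv fu AE_space
  proof eventually_elim
    case (elim t)
    then have "0 \<le> t" by (simp add: space_restrict_space)
    then have "u t \<in> U" by (rule u(2))
    moreover obtain w where "w \<in> argmin_controls f U V t (x t)" "v t = f (t, x t, w)"
      using elim by (auto simp: F_def)
    ultimately show ?case using elim by (auto simp: mem_argmin_controls)
  qed
  ultimately show ?thesis using xX by blast
qed

end
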